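(* Let $X\subset\mathbb{P}_n$ be an arithmetically Cohen-Macaulay projective subscheme of pure dimension $m\ge1$ and degree $d$, with characteristic sequence $(m_i)_{0\le i\le d-1}$, and let $Y\subset X$ be an ACM hypersurface of $X$ with relative characteristic sequence $(n_i)_{0\le i\le d-1}$. Then the absolute characteristic sequence of $Y$ is $$(m_0,m_0+1,\dots,n_0-1)\oplus(m_1,\dots,n_1-1)\oplus\dots\oplus(m_{d-1},\dots,n_{d-1}-1),$$ where $\oplus$ denotes the sum of sequences obtained by adding multiplicities (multiset union, rearranged in increasing order), and $(m_i,\dots,n_i-1)$ is empty when $n_i=m_i$.
   Context: $k$ is an algebraically closed field of characteristic $0$, $A_n=k[X_0,\dots,X_n]$. A projective subscheme $X\subset\mathbb{P}_n$ is given by its saturated homogeneous ideal $I_X$; $A_X=A_n/I_X$ and $\phi_X(l)=\dim_k A_X(l)$. $B[a](l)=B(a+l)$ denotes the shift of a graded module. $X$ of dimension $m$ is arithmetically Cohen-Macaulay (ACM) if $A_X$ admits a regular sequence of $m+1$ homogeneous polynomials. Characteristic sequence: if $X$ is ACM of pure dimension $m$ and degree $d$, and $Y_0,\dots,Y_m$ are linear forms whose common zero locus does not meet $X$, put $R_m=k[Y_0,\dots,Y_m]$. Then $A_X\simeq\bigoplus_{i=0}^{d-1}R_m[-m_i]$ as graded $R_m$-modules with $0=m_0\le\dots\le m_{d-1}$; the sequence $(m_i)$ depends only on $\phi_X$ and is the (absolute) characteristic sequence of $X$. The same definition applied to $Y$ (with $m-1$ in place of $m$ and $\deg Y$ in place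 of $d$) gives the absolute characteristic sequence of $Y$. Relative characteristic sequence: an ACM hypersurface of $X$ is an ACM closed subscheme $Y\subset X$ of pure dimension $m-1$. The kernel $I_{Y/X}=I_Y/I_X$ of $A_X\to A_Y$ is a graded free $R_m$-module of rank $d$, $I_{Y/X}\simeq\bigoplus_{i=0}^{d-1}R_m[-n_i]$ with $n_0\le\dots\le n_{d-1}$; $(n_i)$ is the relative characteristic sequence of $Y$ (relative to $X$). *)

theory Defs
  imports
    "HOL-Algebra.QuotRing"
    "HOL-Algebra.Embedded_Algebras"
    "HOL-Algebra.Module"
    "HOL-Library.Poly_Mapping"
    "HOL-Computational_Algebra.Polynomial"
begin

section \<open>Polynomial rings\<close>

text \<open>
  Polynomials in the countably many indeterminates \<open>X\<^sub>0, X\<^sub>1, \<dots>\<close>; the ring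
  \<open>k[X\<^sub>0,\<dots>,X\<^sub>n]\<close> is the subring \<open>poly_ring n\<close>.
\<close>

type_synonym 'k mpoly = "(nat \<Rightarrow>\<^sub>0 nat) \<Rightarrow>\<^sub>0 'k"

definition mono_deg :: "(nat \<Rightarrow>\<^sub>0 nat) \<Rightarrow> nat" where
  "mono_deg t = (\<Sum>i\<in>Poly_Mapping.keys t. Poly_Mapping.lookup t i)"

definition var :: "nat \<Rightarrow> 'k::field mpoly" where
  "var i = Poly_Mapping.single (Poly_Mapping.single i 1) 1"

definition const :: "'k::field \<Rightarrow> 'k mpoly" where
  "const c = Poly_Mapping.single 0 c"

definition polys :: "nat \<Rightarrow> 'k::field mpoly set" where
  "polys n = {p. \<forall>t\<in>Poly_Mapping.keys p. Poly_Mapping.keys t \<subseteq> {..n}}"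

definition poly_ring :: "nat \<Rightarrow> 'k::field mpoly ring" where
  "poly_ring n = \<lparr>carrier = polys n, monoid.mult = (*), one = 1, zero = 0, add = (+)\<rparr>"

definition homog :: "nat \<Rightarrow> 'k::field mpoly \<Rightarrow> bool" where
  "homog l p \<longleftrightarrow> (\<forall>t\<in>Poly_Mapping.keys p. mono_deg t = l)"

text \<open>The value of \<open>p\<close> under the substitution \<open>X\<^sub>i \<mapsto> Ys ! i\<close>.\<close>

definition subst :: "'k::field mpoly list \<Rightarrow> 'k mpoly \<Rightarrow> 'k mpoly" where
  "subst Ys p = (\<Sum>t\<in>Poly_Mapping.keys p. const (Poly_Mapping.lookup p t) *
      (\<Prod>i\<in>Poly_Mapping.keys t. (Ys ! i) ^ Poly_Mapping.lookup t i))"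


section \<open>Projective subschemes\<close>

definition homog_ideal :: "nat \<Rightarrow> 'k::field mpoly set \<Rightarrow> bool" where
  "homog_ideal n I \<longleftrightarrow> ideal I (poly_ring n) \<and>
     Idl\<^bsub>poly_ring n\<^esub> {p \<in> I. \<exists>l. homog l p} = I"

definition saturated :: "nat \<Rightarrow> 'k::field mpoly set \<Rightarrow> bool" where
  "saturated n I \<longleftrightarrow> (\<forall>f\<in>polys n. \<forall>N.
     (\<forall>g\<in>polys n. homog N g \<longrightarrow> g * f \<in> I) \<longrightarrow> f \<in> I)"

text \<open>A closed subscheme of \<open>\<P>\<^sub>n\<close>, represented by its ideal.\<close>

definition proj_subscheme :: "nat \<Rightarrow> 'k::field mpoly set \<Rightarrow> bool" where
  "proj_subscheme n I \<longleftrightarrow> homog_ideal n I \<and> saturated n I"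

definition coord_ring :: "nat \<Rightarrow> 'k::field mpoly set \<Rightarrow> 'k mpoly set ring" where
  "coord_ring n I = poly_ring n Quot I"

definition residue :: "nat \<Rightarrow> 'k::field mpoly set \<Rightarrow> 'k mpoly \<Rightarrow> 'k mpoly set" where
  "residue n I f = I +>\<^bsub>poly_ring n\<^esub> f"

definition coord_grade :: "nat \<Rightarrow> 'k::field mpoly set \<Rightarrow> nat \<Rightarrow> 'k mpoly set set" where
  "coord_grade n I l = residue n I ` {f \<in> polys n. homog l f}"

definition hilbert_fun :: "nat \<Rightarrow> 'k::field mpoly set \<Rightarrow> nat \<Rightarrow> nat" where
  "hilbert_fun n I l =
     ring.dim (coord_ring n I) (range (\<lambda>c. residue n I (const c))) (coord_grade n I l)"

text \<open>
  The points of the scheme, that is, the homogeneous primes of \<open>Proj k[X\<^sub>0,\<dots>,X\<^sub>n]\<close> containing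
  \<open>I\<close>. If \<open>P\<close> is such a point, \<open>proj_points n P\<close> is its closure.
\<close>

definition proj_points :: "nat \<Rightarrow> 'k::field mpoly set \<Rightarrow> 'k mpoly set set" where
  "proj_points n I = {P. primeideal P (poly_ring n) \<and> homog_ideal n P \<and> I \<subseteq> P \<and>
     \<not> (\<forall>i\<le>n. var i \<in> P)}"

text \<open>Chains of \<open>m + 1\<close> points correspond to chains of irreducible closed subsets of length \<open>m\<close>.\<close>

definition has_dim :: "nat \<Rightarrow> 'k::field mpoly set \<Rightarrow> nat \<Rightarrow> bool" where
  "has_dim n I m \<longleftrightarrow>
     (\<exists>C. C \<subseteq> proj_points n I \<and> chain\<^sub>\<subseteq> C \<and> card C = m + 1) \<and>
     (\<forall>C. C \<subseteq> proj_points n I \<and> chain\<^sub>\<subseteq> C \<longrightarrow> finite C \<and> card C \<le> m + 1)"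

text \<open>
  The irreducible components are the closures of the minimal points. The empty scheme is excluded.
\<close>

definition pure_dim :: "nat \<Rightarrow> 'k::field mpoly set \<Rightarrow> nat \<Rightarrow> bool" where
  "pure_dim n I m \<longleftrightarrow> proj_points n I \<noteq> {} \<and>
     (\<forall>P\<in>proj_points n I. (\<forall>Q\<in>proj_points n I. Q \<subseteq> P \<longrightarrow> Q = P) \<longrightarrow> has_dim n P m)"

text \<open>The Hilbert polynomial of a scheme of dimension \<open>m\<close> and degree \<open>d\<close> is \<open>d l\<^sup>m / m! + \<dots>\<close>.\<close>

definition has_degree :: "nat \<Rightarrow> 'k::field mpoly set \<Rightarrow> nat \<Rightarrow> nat \<Rightarrow> bool" where
  "has_degree n I m d \<longleftrightarrow> (\<exists>H :: rat poly.
     Polynomial.degree H = m \<and> Polynomial.lead_coeff H = of_nat d / fact m \<and>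
     (\<forall>\<^sub>F l in sequentially. of_nat (hilbert_fun n I l) = poly H (of_nat l)))"

definition regular_seq :: "('a, 'b) ring_scheme \<Rightarrow> 'a list \<Rightarrow> bool" where
  "regular_seq R fs \<longleftrightarrow> set fs \<subseteq> carrier R \<and> Idl\<^bsub>R\<^esub> (set fs) \<noteq> carrier R \<and>
     (\<forall>i<length fs. \<forall>a\<in>carrier R.
        fs ! i \<otimes>\<^bsub>R\<^esub> a \<in> Idl\<^bsub>R\<^esub> (set (take i fs)) \<longrightarrow> a \<in> Idl\<^bsub>R\<^esub> (set (take i fs)))"

definition arith_CM :: "nat \<Rightarrow> 'k::field mpoly set \<Rightarrow> nat \<Rightarrow> bool" where
  "arith_CM n I m \<longleftrightarrow> (\<exists>fs. length fs = m + 1 \<and> (\<forall>f\<in>set fs. \<exists>l. f \<in> coord_grade n I l) \<and>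
     regular_seq (coord_ring n I) fs)"

definition ACM_hypersurface ::
    "nat \<Rightarrow> 'k::field mpoly set \<Rightarrow> nat \<Rightarrow> 'k mpoly set \<Rightarrow> bool" where
  "ACM_hypersurface n IX m IY \<longleftrightarrow> proj_subscheme n IY \<and> IX \<subseteq> IY \<and>
     pure_dim n IY (m - 1) \<and> arith_CM n IY (m - 1)"


section \<open>Graded modules and characteristic sequences\<close>

text \<open>Gradings by \<open>\<nat>\<close> suffice: the modules below vanish in negative degrees.\<close>

record ('a, 'b) graded_module = "('a, 'b) module" +
  grade :: "nat \<Rightarrow> 'b set"

definition graded_iso ::
    "('a, 'c) ring_scheme \<Rightarrow> ('a, 'b1) graded_module \<Rightarrow> ('a, 'b2) graded_module \<Rightarrow> bool" where
  "graded_iso R M N \<longleftrightarrow> (\<exists>h. bij_betw h (carrier M) (carrier N) \<and>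
     (\<forall>x\<in>carrier M. \<forall>y\<in>carrier M. h (x \<oplus>\<^bsub>M\<^esub> y) = h x \<oplus>\<^bsub>N\<^esub> h y) \<and>
     (\<forall>r\<in>carrier R. \<forall>x\<in>carrier M. h (r \<odot>\<^bsub>M\<^esub> x) = r \<odot>\<^bsub>N\<^esub> h x) \<and>
     (\<forall>l. h ` grade M l = grade N l))"

text \<open>
  The graded module \<open>\<Oplus>\<^sub>i R\<^sub>m[-q\<^sub>i]\<close> over \<open>R\<^sub>m = poly_ring m\<close>; its homogeneous part of degree \<open>l\<close>
  is \<open>\<Oplus>\<^sub>i R\<^sub>m(l - q\<^sub>i)\<close>. The fields \<open>mult\<close> and \<open>one\<close> of the record have no meaning for modules.
\<close>

definition shifted_sum ::
    "nat \<Rightarrow> nat list \<Rightarrow> ('k::field mpoly, nat \<Rightarrow> 'k mpoly) graded_module" where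
  "shifted_sum m qs =
     (let V = {v. (\<forall>i<length qs. v i \<in> polys m) \<and> (\<forall>i\<ge>length qs. v i = 0)}
      in \<lparr>carrier = V, monoid.mult = undefined, one = undefined,
          zero = (\<lambda>i. 0), add = (\<lambda>v w i. v i + w i),
          module.smult = (\<lambda>r v i. r * v i),
          grade = (\<lambda>l. {v \<in> V. \<forall>i<length qs.
             if qs ! i \<le> l then homog (l - qs ! i) (v i) else v i = 0})\<rparr>)"

text \<open>
  \<open>Y\<^sub>0,\<dots>,Y\<^sub>m\<close> are linear forms without common zero on the scheme. The ring \<open>R\<^sub>m = k[Y\<^sub>0,\<dots>,Y\<^sub>m]\<close> is
  taken as the abstract polynomial ring \<open>poly_ring m\<close>, acting on quotients of \<open>k[X\<^sub>0,\<dots>,X\<^sub>n]\<close>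
  through \<open>subst Ys\<close>.
\<close>

definition avoiding_forms :: "nat \<Rightarrow> 'k::field mpoly set \<Rightarrow> nat \<Rightarrow> 'k mpoly list \<Rightarrow> bool" where
  "avoiding_forms n I m Ys \<longleftrightarrow> length Ys = m + 1 \<and> (\<forall>y\<in>set Ys. y \<in> polys n \<and> homog 1 y) \<and>
     \<not> (\<exists>P\<in>proj_points n I. set Ys \<subseteq> P)"

definition coord_module ::
    "nat \<Rightarrow> 'k::field mpoly set \<Rightarrow> 'k mpoly list \<Rightarrow> ('k mpoly, 'k mpoly set) graded_module" where
  "coord_module n I Ys =
     \<lparr>carrier = carrier (coord_ring n I), monoid.mult = monoid.mult (coord_ring n I),
      one = one (coord_ring n I), zero = zero (coord_ring n I), add = add (coord_ring n I),
      module.smult = (\<lambda>r a. residue n I (subst Ys r) \<otimes>\<^bsub>coord_ring n I\<^esub> a),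
      grade = coord_grade n I\<rparr>"

text \<open>The kernel \<open>I\<^sub>Y / I\<^sub>X\<close> of \<open>A\<^sub>X \<rightarrow> A\<^sub>Y\<close> with the structure induced from \<open>A\<^sub>X\<close>.\<close>

definition rel_ideal_module ::
    "nat \<Rightarrow> 'k::field mpoly set \<Rightarrow> 'k mpoly list \<Rightarrow> 'k mpoly set
       \<Rightarrow> ('k mpoly, 'k mpoly set) graded_module" where
  "rel_ideal_module n IX Ys IY =
     (coord_module n IX Ys)
       \<lparr>carrier := residue n IX ` IY, grade := (\<lambda>l. residue n IX ` IY \<inter> coord_grade n IX l)\<rparr>"

text \<open>
  Characteristic sequences computed with given forms \<open>Ys\<close>; the length is the degree of the scheme
  (of \<open>X\<close> in the relative case), expressed through \<open>has_degree\<close>.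
\<close>

definition char_seq_wrt ::
    "nat \<Rightarrow> 'k::field mpoly set \<Rightarrow> nat \<Rightarrow> 'k mpoly list \<Rightarrow> nat list \<Rightarrow> bool" where
  "char_seq_wrt n I m Ys ms \<longleftrightarrow> avoiding_forms n I m Ys \<and> has_degree n I m (length ms) \<and>
     sorted ms \<and> ms \<noteq> [] \<and> ms ! 0 = 0 \<and>
     graded_iso (poly_ring m) (coord_module n I Ys) (shifted_sum m ms)"

definition char_seq :: "nat \<Rightarrow> 'k::field mpoly set \<Rightarrow> nat \<Rightarrow> nat list \<Rightarrow> bool" where
  "char_seq n I m ms \<longleftrightarrow> (\<exists>Ys. char_seq_wrt n I m Ys ms)"

definition rel_char_seq_wrt ::
    "nat \<Rightarrow> 'k::field mpoly set \<Rightarrow> nat \<Rightarrow> 'k mpoly list \<Rightarrow> 'k mpoly set \<Rightarrow> nat list \<Rightarrow> bool" where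
  "rel_char_seq_wrt n IX m Ys IY ns \<longleftrightarrow> avoiding_forms n IX m Ys \<and>
     has_degree n IX m (length ns) \<and> sorted ns \<and>
     graded_iso (poly_ring m) (rel_ideal_module n IX Ys IY) (shifted_sum m ns)"

end

theory Submission
  imports Defs "HOL-Library.Multiset"
begin

text \<open>
  Write \<open>0 \<rightarrow> N \<rightarrow> A\<^sub>X \<rightarrow> A\<^sub>Y \<rightarrow> 0\<close> with \<open>N = I\<^bsub>Y/X\<^esub>\<close> and \<open>A\<^sub>X\<close> free over \<open>R\<^sub>m\<close> of the same rank.
  Comparing Hilbert functions determines the characteristic sequence of \<open>Y\<close>, provided it exists.

  For existence, let \<open>a\<close> be the matrix of \<open>N \<rightarrow> A\<^sub>X\<close> over \<open>R\<^sub>m\<close>. Equality of ranks yields a homogeneous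
  \<open>\<delta> \<noteq> 0\<close> in \<open>R\<^sub>m\<close> annihilating \<open>A\<^sub>Y\<close>, and then \<open>a s = \<delta>\<close> for some matrix \<open>s\<close>. At a point \<open>u\<close> with
  \<open>u\<^sub>m = 1\<close> and \<open>\<delta>(u) \<noteq> 0\<close> the matrix \<open>a(u)\<close> is invertible. Take \<open>Z\<^sub>j = Y\<^sub>j - u\<^sub>j Y\<^sub>m\<close> for \<open>j < m\<close>. Since
  \<open>R\<^sub>m/(Z) = k[Y\<^sub>m]\<close> is evaluation at \<open>u\<close>, the quotient \<open>A\<^sub>Y/(Z)\<close> is spanned in degree \<open>l\<close> by
  \<open>#{i. m\<^sub>i \<le> l} - #{i. n\<^sub>i \<le> l}\<close> elements; this number is the multiplicity of \<open>l\<close> in the claimed sequence.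
  By Nakayama lifts of these elements generate \<open>A\<^sub>Y\<close> over \<open>k[Z]\<close>, and by the Hilbert function of \<open>A\<^sub>Y\<close>
  they are free generators.
\<close>

subsection \<open>Evaluation of polynomials\<close>

text \<open>The forms Y_0, ..., Y_m are one too many for Y, and omitting one of them may leave forms
  with a common zero on Y. Geometrically, (Y_0 : ... : Y_m) maps X to P_m and sends Y into the
  hypersurface \<delta> = 0; the Z_j are the coordinates of the projection from a point u off that
  hypersurface, which is why they have no common zero on Y. Such a u exists because the field is
  infinite, and scaling gives u_m = 1. The intervals come from R_m[-a]/R_m[-b], which has the
  Hilbert function of the sum of the R_(m-1)[-q] with a \<le> q < b. The inequality m_i \<le> n_i is
  a consequence of the invertibility of a(u): for degree reasons its rows with n_k \<le> l are
  supported on the columns with m_i \<le> l, so there are at most as many of the former as of the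
  latter. The annihilator comes from growth: with equal ranks, dim A_Y(l) is O(l^(m-1)), too small
  for an injective copy of R_m. Linear algebra is done with the degree-l parts of pairs of ideals I
  and J, I contained in J, rather than with quotient spaces.\<close>

abbreviation lookup where "lookup \<equiv> Poly_Mapping.lookup"
abbreviation keys where "keys \<equiv> Poly_Mapping.keys"
abbreviation mterm :: "(nat \<Rightarrow>\<^sub>0 nat) \<Rightarrow> 'k::field \<Rightarrow> 'k mpoly" where "mterm \<equiv> Poly_Mapping.single"

lemma mpoly_sum_single: "p = (\<Sum>t\<in>keys p. mterm t (lookup p t))"
proof (rule poly_mapping_eqI)
  fix s
  show "lookup p s = lookup (\<Sum>t\<in>keys p. mterm t (lookup p t)) s"
    by (simp add: lookup_sum lookup_single when_def sum.delta in_keys_iff)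
qed

definition mval :: "(nat \<Rightarrow> 'a::comm_ring_1) \<Rightarrow> (nat \<Rightarrow>\<^sub>0 nat) \<Rightarrow> 'a" where
  "mval x t = (\<Prod>i\<in>keys t. x i ^ lookup t i)"

lemma mval_superset:
  assumes "finite S" "keys t \<subseteq> S"
  shows "mval x t = (\<Prod>i\<in>S. x i ^ lookup t i)"
  unfolding mval_def
  by (rule prod.mono_neutral_left) (use assms in \<open>auto simp: in_keys_iff\<close>)

lemma mval_0 [simp]: "mval x 0 = 1"
  by (simp add: mval_def)

lemma mval_add: "mval x (s + t) = mval x s * mval x t"
proof -
  let ?S = "keys s \<union> keys t"
  have "keys (s + t) \<subseteq> ?S" by (rule keys_add)
  then have "mval x (s + t) = (\<Prod>i\<in>?S. x i ^ lookup (s + t) i)"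
    by (intro mval_superset) auto
  also have "\<dots> = (\<Prod>i\<in>?S. x i ^ lookup s i) * (\<Prod>i\<in>?S. x i ^ lookup t i)"
    by (simp add: lookup_add power_add prod.distrib)
  also have "\<dots> = mval x s * mval x t"
    using mval_superset[of ?S s x] mval_superset[of ?S t x] by simp
  finally show ?thesis .
qed

lemma mval_single [simp]: "mval x (Poly_Mapping.single i a) = x i ^ a"
  by (cases "a = 0") (simp_all add: mval_def)

text \<open>One notion covers both evaluations in use: \<open>sb\<close> substitutes polynomials
  (\<phi> is \<open>const\<close>), \<open>pt\<close> evaluates at a point over the field (\<phi> is
  the identity).\<close>

locale evaluation =
  fixes \<phi> :: "'k::field \<Rightarrow> 'a::comm_ring_1"
  assumes phi_0: "\<phi> 0 = 0" and phi_1: "\<phi> 1 = 1"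
    and phi_add: "\<phi> (a + b) = \<phi> a + \<phi> b" and phi_mult: "\<phi> (a * b) = \<phi> a * \<phi> b"
begin

definition ev :: "(nat \<Rightarrow> 'a) \<Rightarrow> 'k mpoly \<Rightarrow> 'a" where
  "ev x p = (\<Sum>t\<in>keys p. \<phi> (lookup p t) * mval x t)"

lemma ev_superset:
  assumes "finite S" "keys p \<subseteq> S"
  shows "ev x p = (\<Sum>t\<in>S. \<phi> (lookup p t) * mval x t)"
  unfolding ev_def
  by (rule sum.mono_neutral_left) (use assms in \<open>auto simp: in_keys_iff phi_0\<close>)

lemma ev_0 [simp]: "ev x 0 = 0"
  by (simp add: ev_def)

lemma ev_single [simp]: "ev x (mterm t c) = \<phi> c * mval x t"
  by (cases "c = 0") (simp_all add: ev_def phi_0)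

lemma ev_1 [simp]: "ev x 1 = 1"
  using ev_single[of x 0 1] by (simp add: phi_1)

lemma ev_add: "ev x (p + q) = ev x p + ev x q"
proof -
  let ?S = "keys p \<union> keys q"
  have "keys (p + q) \<subseteq> ?S" by (rule keys_add)
  then have "ev x (p + q) = (\<Sum>t\<in>?S. \<phi> (lookup (p + q) t) * mval x t)"
    by (intro ev_superset) auto
  also have "\<dots> = (\<Sum>t\<in>?S. \<phi> (lookup p t) * mval x t) + (\<Sum>t\<in>?S. \<phi> (lookup q t) * mval x t)"
    by (simp add: lookup_add phi_add distrib_right sum.distrib)
  also have "\<dots> = ev x p + ev x q"
    using ev_superset[of ?S p x] ev_superset[of ?S q x] by simp
  finally show ?thesis .
qed

lemma ev_sum: "ev x (sum f A) = (\<Sum>a\<in>A. ev x (f a))"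
  by (induction A rule: infinite_finite_induct) (simp_all add: ev_add)

lemma ev_mult: "ev x (p * q) = ev x p * ev x q"
proof -
  have "p * q = (\<Sum>s\<in>keys p. mterm s (lookup p s)) * (\<Sum>t\<in>keys q. mterm t (lookup q t))"
    using mpoly_sum_single[of p] mpoly_sum_single[of q] by simp
  also have "\<dots> = (\<Sum>s\<in>keys p. \<Sum>t\<in>keys q. mterm (s + t) (lookup p s * lookup q t))"
    by (simp add: sum_product mult_single)
  finally have "ev x (p * q) = (\<Sum>s\<in>keys p. \<Sum>t\<in>keys q. (\<phi> (lookup p s) * mval x s) * (\<phi> (lookup q t) * mval x t))"
    by (simp add: ev_sum phi_mult mval_add mult_ac)
  also have "\<dots> = ev x p * ev x q"
    by (simp add: ev_def sum_product)
  finally show ?thesis .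
qed

lemma ev_minus: "ev x (p - q) = ev x p - ev x q"
  using ev_add[of x "p - q" q] by simp

lemma ev_var [simp]: "ev x (var i) = x i"
  by (simp add: var_def phi_1)

lemma ev_const [simp]: "ev x (const c) = \<phi> c"
  by (simp add: const_def)

end

lemma const_0 [simp]: "const 0 = 0" and const_1 [simp]: "const 1 = 1"
  by (simp_all add: const_def)

lemma const_add: "const (a + b) = const a + const b"
  by (simp add: const_def single_add)

lemma const_mult: "const (a * b) = const a * const b"
  by (simp add: const_def mult_single)

lemma const_minus: "const (a - b) = const a - const b"
  by (simp add: const_def single_diff)

lemma const_sum: "const (sum f A) = (\<Sum>a\<in>A. const (f a))"
  by (induction A rule: infinite_finite_induct) (simp_all add: const_add)

interpretation sb: evaluation "const :: 'k::field \<Rightarrow> 'k mpoly"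
  by standard (simp_all add: const_add const_mult)

interpretation pt: evaluation "\<lambda>c. c :: 'k::field"
  by standard simp_all

lemma subst_eq_ev: "subst Ys = sb.ev ((!) Ys)"
  by (simp add: fun_eq_iff subst_def sb.ev_def mval_def)

lemmas subst_simps = sb.ev_add[of "(!) Ys" for Ys, folded subst_eq_ev]
  sb.ev_mult[of "(!) Ys" for Ys, folded subst_eq_ev]
  sb.ev_minus[of "(!) Ys" for Ys, folded subst_eq_ev]

lemmas subst_base [simp] = sb.ev_0[of "(!) Ys" for Ys, folded subst_eq_ev]
  sb.ev_1[of "(!) Ys" for Ys, folded subst_eq_ev]
  sb.ev_var[of "(!) Ys" for Ys, folded subst_eq_ev]
  sb.ev_const[of "(!) Ys" for Ys, folded subst_eq_ev]
  sb.ev_single[of "(!) Ys" for Ys, folded subst_eq_ev]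

lemmas subst_sum = sb.ev_sum[of "(!) Ys" for Ys, folded subst_eq_ev]

subsection \<open>Homogeneous components\<close>

lemma mono_deg_superset:
  assumes "finite S" "keys t \<subseteq> S"
  shows "mono_deg t = (\<Sum>i\<in>S. lookup t i)"
  unfolding mono_deg_def
  by (rule sum.mono_neutral_left) (use assms in \<open>auto simp: in_keys_iff\<close>)

lemma mono_deg_0 [simp]: "mono_deg 0 = 0"
  by (simp add: mono_deg_def)

lemma mono_deg_single [simp]: "mono_deg (Poly_Mapping.single i a) = a"
  by (cases "a = 0") (simp_all add: mono_deg_def)

lemma mono_deg_add: "mono_deg (s + t) = mono_deg s + mono_deg t"
proof -
  let ?S = "keys s \<union> keys t"
  have "keys (s + t) \<subseteq> ?S" by (rule keys_add)
  then have "mono_deg (s + t) = (\<Sum>i\<in>?S. lookup (s + t) i)"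
    by (intro mono_deg_superset) auto
  also have "\<dots> = (\<Sum>i\<in>?S. lookup s i) + (\<Sum>i\<in>?S. lookup t i)"
    by (simp add: lookup_add sum.distrib)
  also have "\<dots> = mono_deg s + mono_deg t"
    using mono_deg_superset[of ?S s] mono_deg_superset[of ?S t] by simp
  finally show ?thesis .
qed

lemma mono_deg_eq_0_iff [simp]: "mono_deg t = 0 \<longleftrightarrow> t = 0"
proof
  assume "mono_deg t = 0"
  then show "t = 0" by (intro poly_mapping_eqI) (auto simp: mono_deg_def in_keys_iff)
qed simp

lemma homog_0 [simp]: "homog l 0"
  by (simp add: homog_def)

lemma homog_add: "homog l p \<Longrightarrow> homog l q \<Longrightarrow> homog l (p + q)"
  using keys_add[of p q] by (auto simp: homog_def)

lemma homog_sum: "(\<And>a. a \<in> A \<Longrightarrow> homog l (f a)) \<Longrightarrow> homog l (sum f A)"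
  by (induction A rule: infinite_finite_induct) (simp_all add: homog_add)

lemma homog_single [simp]: "homog l (mterm t c) \<longleftrightarrow> c = 0 \<or> mono_deg t = l"
  by (simp add: homog_def)

lemma homog_mult: "homog l p \<Longrightarrow> homog l' q \<Longrightarrow> homog (l + l') (p * q)"
  using keys_mult[of p q] by (fastforce simp: homog_def mono_deg_add)

lemma homog_const [simp]: "homog 0 (const c)"
  by (simp add: const_def)

lemma homog_1 [simp]: "homog 0 1"
  using homog_const[of 1] by simp

lemma homog_const_mult: "homog l p \<Longrightarrow> homog l (const c * p)"
  using homog_mult[of 0 "const c" l p] by simp

lemma homog_uminus: "homog l p \<Longrightarrow> homog l (- p)"
  by (simp add: homog_def in_keys_iff)

lemma homog_diff: "homog l p \<Longrightarrow> homog l q \<Longrightarrow> homog l (p - q)"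
  using homog_add[of l p "- q"] by (simp add: homog_uminus)

lemma homog_var [simp]: "homog 1 (var i)"
  by (simp add: var_def)

lemma homog_power: "homog l p \<Longrightarrow> homog (a * l) (p ^ a)"
  by (induction a) (auto intro: homog_mult)

lemma homog_prod:
  "finite A \<Longrightarrow> (\<And>a. a \<in> A \<Longrightarrow> homog (d a) (f a)) \<Longrightarrow> homog (sum d A) (prod f A)"
  by (induction A rule: finite_induct) (auto intro: homog_mult)

lemma homog_subst:
  assumes "\<And>t i. t \<in> keys r \<Longrightarrow> i \<in> keys t \<Longrightarrow> homog 1 (Ys ! i)" "homog l r"
  shows "homog l (subst Ys r)"
  unfolding subst_def
proof (rule homog_sum)
  fix t assume t: "t \<in> keys r"
  have "homog (\<Sum>i\<in>keys t. lookup t i) (\<Prod>i\<in>keys t. (Ys ! i) ^ lookup t i)"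
    by (rule homog_prod) (use homog_power[of 1] assms(1)[OF t] in auto)
  moreover have "(\<Sum>i\<in>keys t. lookup t i) = l"
    using assms(2) t by (auto simp: homog_def mono_deg_def)
  ultimately show "homog l (const (lookup r t) * (\<Prod>i\<in>keys t. (Ys ! i) ^ lookup t i))"
    by (simp add: homog_const_mult)
qed

definition hc :: "nat \<Rightarrow> 'k::field mpoly \<Rightarrow> 'k mpoly" where
  "hc l p = Poly_Mapping.mapp (\<lambda>t c. if mono_deg t = l then c else 0) p"

lemma lookup_hc: "lookup (hc l p) t = (if mono_deg t = l then lookup p t else 0)"
  by (simp add: hc_def lookup_mapp when_def in_keys_iff)

lemma homog_hc [simp]: "homog l (hc l p)"
  by (auto simp: homog_def in_keys_iff lookup_hc split: if_splits)

lemma hc_add: "hc l (p + q) = hc l p + hc l q"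
  by (rule poly_mapping_eqI) (simp add: lookup_hc lookup_add)

lemma hc_0 [simp]: "hc l 0 = 0"
  by (rule poly_mapping_eqI) (simp add: lookup_hc)

lemma hc_sum: "hc l (sum f A) = (\<Sum>a\<in>A. hc l (f a))"
  by (induction A rule: infinite_finite_induct) (simp_all add: hc_add)

lemma hc_homog: "homog l p \<Longrightarrow> hc l' p = (if l' = l then p else 0)"
  by (rule poly_mapping_eqI) (auto simp: lookup_hc homog_def in_keys_iff)

text \<open>Any bound above the total of all monomial degrees works. The form "for all M beyond N"
  allows the bound to be enlarged so that a prescribed degree l lies in the range of
  summation.\<close>

lemma hc_expand: "\<exists>N. \<forall>M\<ge>N. p = (\<Sum>l\<le>M. hc l p)"
proof (intro exI allI impI poly_mapping_eqI)
  fix M t assume M: "(\<Sum>t\<in>keys p. mono_deg t) \<le> M"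
  show "lookup p t = lookup (\<Sum>l\<le>M. hc l p) t"
  proof (cases "t \<in> keys p")
    case True
    then have "mono_deg t \<le> M"
      using M member_le_sum[of t "keys p" mono_deg] by simp
    then show ?thesis by (simp add: lookup_sum lookup_hc)
  next
    case False
    then show ?thesis by (simp add: lookup_sum lookup_hc in_keys_iff)
  qed
qed

lemma hc_eq_0_imp: "(\<And>l. hc l p = 0) \<Longrightarrow> p = 0"
  using hc_expand[of p] by auto

lemma hc_mult_homog:
  assumes "homog a q"
  shows "hc l (p * q) = (if a \<le> l then hc (l - a) p * q else 0)"
proof -
  obtain N where N: "\<And>M. M \<ge> N \<Longrightarrow> p = (\<Sum>j\<le>M. hc j p)" using hc_expand[of p] by auto
  let ?M = "N + l"
  have "hc l (p * q) = hc l (\<Sum>j\<le>?M. hc j p * q)"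
    using N[of ?M] by (metis le_add1 sum_distrib_right)
  also have "\<dots> = (\<Sum>j\<le>?M. if j + a = l then hc j p * q else 0)"
    unfolding hc_sum
  proof (rule sum.cong)
    fix j
    show "hc l (hc j p * q) = (if j + a = l then hc j p * q else 0)"
      using hc_homog[OF homog_mult[OF homog_hc assms]] by auto
  qed simp
  also have "\<dots> = (if a \<le> l then hc (l - a) p * q else 0)"
  proof (cases "a \<le> l")
    case True
    then have "\<And>j. j + a = l \<longleftrightarrow> j = l - a" by auto
    then show ?thesis using True by simp
  next
    case False
    then show ?thesis by simp
  qed
  finally show ?thesis .
qed

subsection \<open>The polynomial rings\<close>

lemma polys_0 [simp]: "0 \<in> polys n"
  by (simp add: polys_def)

lemma polys_add: "p \<in> polys n \<Longrightarrow> q \<in> polys n \<Longrightarrow> p + q \<in> polys n"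
  using keys_add[of p q] by (auto simp: polys_def)

lemma polys_uminus: "p \<in> polys n \<Longrightarrow> - p \<in> polys n"
  by (simp add: polys_def in_keys_iff)

lemma polys_diff: "p \<in> polys n \<Longrightarrow> q \<in> polys n \<Longrightarrow> p - q \<in> polys n"
  using polys_add[of p n "- q"] by (simp add: polys_uminus)

lemma polys_single: "mterm t c \<in> polys n \<longleftrightarrow> c = 0 \<or> keys t \<subseteq> {..n}"
  by (simp add: polys_def)

lemma polys_const [simp]: "const c \<in> polys n"
  by (simp add: const_def polys_single)

lemma polys_1 [simp]: "1 \<in> polys n"
  using polys_const[of 1] by simp

lemma polys_mult: "p \<in> polys n \<Longrightarrow> q \<in> polys n \<Longrightarrow> p * q \<in> polys n"
proof -
  assume p: "p \<in> polys n" and q: "q \<in> polys n"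
  have "keys t \<subseteq> {..n}" if t: "t \<in> keys (p * q)" for t
  proof -
    obtain a b where "t = a + b" "a \<in> keys p" "b \<in> keys q"
      using keys_mult[of p q] t by blast
    then show ?thesis using p q keys_add[of a b] unfolding polys_def by blast
  qed
  then show ?thesis by (auto simp: polys_def)
qed

lemma polys_sum: "(\<And>a. a \<in> A \<Longrightarrow> f a \<in> polys n) \<Longrightarrow> sum f A \<in> polys n"
  by (induction A rule: infinite_finite_induct) (auto intro: polys_add)

lemma polys_prod: "(\<And>a. a \<in> A \<Longrightarrow> f a \<in> polys n) \<Longrightarrow> prod f A \<in> polys n"
  by (induction A rule: infinite_finite_induct) (auto intro: polys_mult)

lemma polys_power: "p \<in> polys n \<Longrightarrow> p ^ a \<in> polys n"
  by (induction a) (auto intro: polys_mult)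

lemma polys_var [simp]: "var i \<in> polys n \<longleftrightarrow> i \<le> n"
  by (simp add: var_def polys_single)

lemma polys_hc: "p \<in> polys n \<Longrightarrow> hc l p \<in> polys n"
  by (auto simp: polys_def in_keys_iff lookup_hc split: if_splits)

lemma polys_subst:
  assumes "\<And>i. i \<le> m \<Longrightarrow> Ys ! i \<in> polys n" "r \<in> polys m"
  shows "subst Ys r \<in> polys n"
  unfolding subst_def
proof (intro polys_sum polys_mult polys_const polys_prod polys_power)
  fix t i assume "t \<in> keys r" "i \<in> keys t"
  then have "i \<le> m" using assms(2) by (auto simp: polys_def)
  then show "Ys ! i \<in> polys n" by (rule assms(1))
qed

lemma homog_subst_polys:
  assumes "\<And>i. i \<le> m \<Longrightarrow> homog 1 (Ys ! i)" "r \<in> polys m" "homog l r"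
  shows "homog l (subst Ys r)"
  by (rule homog_subst[OF assms(1) assms(3)]) (use assms(2) in \<open>auto simp: polys_def\<close>)

lemma poly_ring_simps [simp]:
  "carrier (poly_ring n) = polys n" "x \<otimes>\<^bsub>poly_ring n\<^esub> y = x * y" "\<one>\<^bsub>poly_ring n\<^esub> = 1"
  "\<zero>\<^bsub>poly_ring n\<^esub> = 0" "x \<oplus>\<^bsub>poly_ring n\<^esub> y = x + y"
  by (simp_all add: poly_ring_def)

lemma cring_poly_ring: "cring (poly_ring n)"
proof (rule cringI)
  show "abelian_group (poly_ring n)"
    by (rule abelian_groupI)
      (auto simp: polys_add add_ac intro: bexI[of _ "- x" for x] polys_uminus)
  show "Group.comm_monoid (poly_ring n)"
    by (rule comm_monoidI) (auto simp: polys_mult mult_ac)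
qed (simp add: distrib_right)

interpretation PR: cring "poly_ring n" for n
  by (rule cring_poly_ring)

lemma poly_ring_a_inv: "x \<in> polys n \<Longrightarrow> \<ominus>\<^bsub>poly_ring n\<^esub> x = - x"
  by (rule PR.minus_equality) (auto simp: polys_uminus)

lemma poly_ring_minus: "x \<in> polys n \<Longrightarrow> y \<in> polys n \<Longrightarrow> x \<ominus>\<^bsub>poly_ring n\<^esub> y = x - y"
  by (simp add: a_minus_def poly_ring_a_inv)

lemma poly_ring_idealI:
  fixes I :: "'k::field mpoly set"
  assumes "I \<subseteq> polys n" "0 \<in> I" "\<And>x y. x \<in> I \<Longrightarrow> y \<in> I \<Longrightarrow> x + y \<in> I"
    and mult: "\<And>r x. x \<in> I \<Longrightarrow> r \<in> polys n \<Longrightarrow> r * x \<in> I"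
  shows "ideal I (poly_ring n)"
proof (rule idealI)
  show "subgroup I (add_monoid (poly_ring n))"
  proof (rule group.subgroupI)
    show "Group.group (add_monoid (poly_ring n))"
      using PR.a_group .
    fix a assume a: "a \<in> I"
    then have "\<ominus>\<^bsub>poly_ring n\<^esub> a = - a" using assms(1) by (intro poly_ring_a_inv) auto
    then show "inv\<^bsub>add_monoid (poly_ring n)\<^esub> a \<in> I"
      using mult[OF a, of "- 1"] by (simp add: a_inv_def polys_uminus)
  qed (use assms in auto)
next
  fix a x :: "'k mpoly"
  assume "a \<in> I" "x \<in> carrier (poly_ring n)"
  then have "x * a \<in> I" by (simp add: mult)
  then show "x \<otimes>\<^bsub>poly_ring n\<^esub> a \<in> I" "a \<otimes>\<^bsub>poly_ring n\<^esub> x \<in> I"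
    by (simp_all add: mult.commute)
qed (rule PR.ring_axioms)

context
  fixes n :: nat and I :: "'k::field mpoly set"
  assumes I: "ideal I (poly_ring n)"
begin

lemma ideal_polys: "x \<in> I \<Longrightarrow> x \<in> polys n"
  using ideal.Icarr[OF I] by simp

lemma ideal_0: "0 \<in> I"
  using additive_subgroup.zero_closed[OF ideal.axioms(1)[OF I]] by simp

lemma ideal_add: "x \<in> I \<Longrightarrow> y \<in> I \<Longrightarrow> x + y \<in> I"
  using additive_subgroup.a_closed[OF ideal.axioms(1)[OF I]] by simp

lemma ideal_mult: "x \<in> I \<Longrightarrow> r \<in> polys n \<Longrightarrow> r * x \<in> I"
  using ideal.I_l_closed[OF I] by simp

lemma ideal_mult': "x \<in> I \<Longrightarrow> r \<in> polys n \<Longrightarrow> x * r \<in> I"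
  using ideal_mult[of x r] by (simp add: mult.commute)

lemma ideal_uminus: "x \<in> I \<Longrightarrow> - x \<in> I"
  using ideal_mult[of x "- 1"] by (simp add: polys_uminus)

lemma ideal_diff: "x \<in> I \<Longrightarrow> y \<in> I \<Longrightarrow> x - y \<in> I"
  using ideal_add[of x "- y"] by (simp add: ideal_uminus)

lemma ideal_sum: "(\<And>a. a \<in> A \<Longrightarrow> f a \<in> I) \<Longrightarrow> sum f A \<in> I"
  by (induction A rule: infinite_finite_induct) (auto intro: ideal_add ideal_0)

lemma residue_eq_iff:
  "x \<in> polys n \<Longrightarrow> y \<in> polys n \<Longrightarrow> residue n I x = residue n I y \<longleftrightarrow> x - y \<in> I"
  using PR.quotient_eq_iff_same_a_r_cos[OF I, of x y]
  by (simp add: residue_def poly_ring_minus)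

lemma coord_ring_simps:
  "carrier (coord_ring n I) = residue n I ` polys n"
  "x \<in> polys n \<Longrightarrow> y \<in> polys n \<Longrightarrow>
     residue n I x \<otimes>\<^bsub>coord_ring n I\<^esub> residue n I y = residue n I (x * y)"
  "x \<in> polys n \<Longrightarrow> y \<in> polys n \<Longrightarrow>
     residue n I x \<oplus>\<^bsub>coord_ring n I\<^esub> residue n I y = residue n I (x + y)"
  "\<zero>\<^bsub>coord_ring n I\<^esub> = residue n I 0" "\<one>\<^bsub>coord_ring n I\<^esub> = residue n I 1"
proof -
  have hom: "residue n I \<in> ring_hom (poly_ring n) (coord_ring n I)"
    using ideal.rcos_ring_hom[OF I] by (simp add: residue_def[abs_def] coord_ring_def)
  show "carrier (coord_ring n I) = residue n I ` polys n"
    by (auto simp: coord_ring_def FactRing_def A_RCOSETS_def' residue_def)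
  show "x \<in> polys n \<Longrightarrow> y \<in> polys n \<Longrightarrow>
     residue n I x \<otimes>\<^bsub>coord_ring n I\<^esub> residue n I y = residue n I (x * y)"
    using ring_hom_mult[OF hom] by simp
  show "x \<in> polys n \<Longrightarrow> y \<in> polys n \<Longrightarrow>
     residue n I x \<oplus>\<^bsub>coord_ring n I\<^esub> residue n I y = residue n I (x + y)"
    using ring_hom_add[OF hom] by simp
  show "\<zero>\<^bsub>coord_ring n I\<^esub> = residue n I 0"
    using ring_hom_zero[OF hom PR.ring_axioms] ideal.quotient_is_ring[OF I]
    by (simp add: coord_ring_def)
  show "\<one>\<^bsub>coord_ring n I\<^esub> = residue n I 1"
    using ring_hom_one[OF hom] by simp
qed

lemma cring_coord_ring: "cring (coord_ring n I)"
  unfolding coord_ring_def by (rule ideal.quotient_is_cring[OF I cring_poly_ring])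

end

text \<open>Homogeneity is given as generation by homogeneous elements. The elements of I all of
  whose components lie in I form an ideal containing these generators, hence all of I.\<close>

lemma homog_ideal_hc:
  fixes I :: "'k::field mpoly set"
  assumes "homog_ideal n I" "f \<in> I"
  shows "hc l f \<in> I"
proof -
  have I: "ideal I (poly_ring n)"
    and gen: "Idl\<^bsub>poly_ring n\<^esub> {p \<in> I. \<exists>l. homog l p} = I"
    using assms(1) by (auto simp: homog_ideal_def)
  define D where "D = {f \<in> I. \<forall>l. hc l f \<in> I}"
  note cl = ideal_polys[OF I] ideal_0[OF I] ideal_add[OF I] ideal_mult[OF I] ideal_sum[OF I]
  have mult: "r * f \<in> D" if f: "f \<in> D" and r: "r \<in> polys n" for f r
  proof -
    obtain N where N: "f = (\<Sum>j\<le>N. hc j f)" using hc_expand[of f] by blast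
    have "hc l (r * f) \<in> I" for l
    proof -
      have "hc l (r * f) = hc l (\<Sum>j\<le>N. r * hc j f)"
        using N by (metis sum_distrib_left)
      also have "\<dots> = (\<Sum>j\<le>N. if j \<le> l then hc (l - j) r * hc j f else 0)"
        by (simp add: hc_sum hc_mult_homog[OF homog_hc])
      also have "\<dots> \<in> I"
        by (rule cl(5)) (use f r in \<open>auto simp: D_def intro: cl(2,4) polys_hc\<close>)
      finally show ?thesis .
    qed
    then show ?thesis using f r by (auto simp: D_def intro: cl(4))
  qed
  have "ideal D (poly_ring n)"
    by (rule poly_ring_idealI[OF _ _ _ mult]) (auto simp: D_def hc_add intro: cl(1-3))
  moreover have "{p \<in> I. \<exists>l. homog l p} \<subseteq> D"
    by (auto simp: D_def hc_homog cl(2))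
  ultimately have "I \<subseteq> D"
    using PR.genideal_minimal[of D n] gen by blast
  then show ?thesis using assms(2) by (auto simp: D_def)
qed

subsection \<open>Linear algebra relative to a subspace\<close>

context vector_space
begin

text \<open>Dimension of U modulo W without a quotient space: a basis of W together with the family
  spans U. The finite set F guarantees that a basis of W is finite.\<close>

lemma dim_le_family:
  assumes "finite F" "W \<subseteq> span F" "finite K"
    and gen: "\<And>u. u \<in> U \<Longrightarrow> \<exists>c. u - (\<Sum>\<kappa>\<in>K. c \<kappa> *s b \<kappa>) \<in> W"
  shows "dim U \<le> dim W + card K"
proof -
  obtain B where B: "B \<subseteq> W" "independent B" "W \<subseteq> span B" "card B = dim W"
    using basis_exists[of W] by blast
  have finB: "finite B"
    using independent_span_bound[OF assms(1) B(2)] B(1) assms(2) by blast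
  have "U \<subseteq> span (B \<union> b ` K)"
  proof
    fix u assume "u \<in> U"
    then obtain c where "u - (\<Sum>\<kappa>\<in>K. c \<kappa> *s b \<kappa>) \<in> W" using gen by blast
    then have "u - (\<Sum>\<kappa>\<in>K. c \<kappa> *s b \<kappa>) \<in> span (B \<union> b ` K)"
      using B(3) span_mono[of B "B \<union> b ` K"] by blast
    moreover have "(\<Sum>\<kappa>\<in>K. c \<kappa> *s b \<kappa>) \<in> span (B \<union> b ` K)"
      by (intro span_sum span_scale span_base) auto
    ultimately show "u \<in> span (B \<union> b ` K)"
      using span_add by fastforce
  qed
  then have "dim U \<le> card (B \<union> b ` K)"
    using finB assms(3) by (intro dim_le_card) auto
  also have "\<dots> \<le> card B + card (b ` K)" by (rule card_Un_le)
  also have "\<dots> \<le> dim W + card K" using B(4) card_image_le[OF assms(3), of b] by simp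
  finally show ?thesis .
qed

text \<open>A basis of W is extended by one \<open>b k\<close> at a time. The induction also records
  that \<open>span B\<close> consists of combinations of the family modulo W, which turns membership
  of the next vector into a forbidden relation.\<close>

lemma dim_ge_family:
  assumes F: "finite F" "U \<subseteq> span F" and W: "subspace W" "W \<subseteq> U" and K: "finite K"
    and b: "\<And>\<kappa>. \<kappa> \<in> K \<Longrightarrow> b \<kappa> \<in> U"
    and ind: "\<And>c. (\<Sum>\<kappa>\<in>K. c \<kappa> *s b \<kappa>) \<in> W \<Longrightarrow> \<forall>\<kappa>\<in>K. c \<kappa> = 0"
  shows "dim W + card K \<le> dim U"
proof -
  have "\<exists>B\<subseteq>U. independent B \<and> finite B \<and> card B = dim W + card K \<and>
      (\<forall>x\<in>span B. \<exists>c. x - (\<Sum>\<kappa>\<in>K. c \<kappa> *s b \<kappa>) \<in> W)"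
    using K b ind
  proof (induction K rule: finite_induct)
    case empty
    obtain B where B: "B \<subseteq> W" "independent B" "W \<subseteq> span B" "card B = dim W"
      using basis_exists[of W] by blast
    have "finite B"
      using independent_span_bound[OF F(1) B(2)] B(1) F(2) W(2) by blast
    moreover have "span B \<subseteq> W" by (rule span_minimal[OF B(1) W(1)])
    ultimately show ?case using B W(2) by (intro exI[of _ B]) auto
  next
    case (insert k K)
    have "\<forall>\<kappa>\<in>K. c \<kappa> = 0" if "(\<Sum>\<kappa>\<in>K. c \<kappa> *s b \<kappa>) \<in> W" for c
    proof -
      have "(\<Sum>\<kappa>\<in>insert k K. (c(k := 0)) \<kappa> *s b \<kappa>) = (\<Sum>\<kappa>\<in>K. (c(k := 0)) \<kappa> *s b \<kappa>)"
        using insert.hyps by simp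
      also have "\<dots> = (\<Sum>\<kappa>\<in>K. c \<kappa> *s b \<kappa>)"
        using insert.hyps by (intro sum.cong) auto
      finally have "\<forall>\<kappa>\<in>insert k K. (c(k := 0)) \<kappa> = 0"
        using insert.prems(2) that by metis
      then show ?thesis using insert.hyps by (metis fun_upd_apply insertCI)
    qed
    then obtain B where B: "B \<subseteq> U" "independent B" "finite B" "card B = dim W + card K"
        "\<And>x. x \<in> span B \<Longrightarrow> \<exists>c. x - (\<Sum>\<kappa>\<in>K. c \<kappa> *s b \<kappa>) \<in> W"
      using insert.IH insert.prems(1) by (metis insertCI)
    have shift: "x - (\<Sum>\<kappa>\<in>insert k K. (c(k := a)) \<kappa> *s b \<kappa>) = x - a *s b k - (\<Sum>\<kappa>\<in>K. c \<kappa> *s b \<kappa>)"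
      for x c a
    proof -
      have "(\<Sum>\<kappa>\<in>K. (c(k := a)) \<kappa> *s b \<kappa>) = (\<Sum>\<kappa>\<in>K. c \<kappa> *s b \<kappa>)"
        using insert.hyps by (intro sum.cong) auto
      then show ?thesis using insert.hyps by (simp add: algebra_simps)
    qed
    have "b k \<notin> span B"
    proof
      assume "b k \<in> span B"
      then obtain c where "b k - (\<Sum>\<kappa>\<in>K. c \<kappa> *s b \<kappa>) \<in> W" using B(5) by blast
      \<comment> \<open>Coefficient -1 at k turns the representation of \<open>b k\<close> into a
        relation modulo W with a nonzero coefficient.\<close>
      then have "0 - (\<Sum>\<kappa>\<in>insert k K. (c(k := - 1)) \<kappa> *s b \<kappa>) \<in> W"
        unfolding shift by simp
      then have "(\<Sum>\<kappa>\<in>insert k K. (c(k := - 1)) \<kappa> *s b \<kappa>) \<in> W"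
        using subspace_neg[OF W(1)] by fastforce
      then have "(c(k := - 1)) k = 0" using insert.prems(2) by (metis insertI1)
      then show False by simp
    qed
    then have "b k \<notin> B" using span_base by blast
    have "\<exists>c. x - (\<Sum>\<kappa>\<in>insert k K. c \<kappa> *s b \<kappa>) \<in> W" if x: "x \<in> span (insert (b k) B)" for x
    proof -
      obtain a where "x - a *s b k \<in> span B" using x by (auto simp: span_breakdown_eq)
      then obtain c where "x - a *s b k - (\<Sum>\<kappa>\<in>K. c \<kappa> *s b \<kappa>) \<in> W" using B(5) by blast
      then show ?thesis unfolding shift[symmetric] by blast
    qed
    then show ?case
      using B insert \<open>b k \<notin> span B\<close> \<open>b k \<notin> B\<close>
      by (intro exI[of _ "insert (b k) B"]) (auto simp: independent_insert)
  qed
  then obtain B where B: "B \<subseteq> U" "independent B" "card B = dim W + card K" by blast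
  obtain A where A: "A \<subseteq> U" "independent A" "U \<subseteq> span A" "card A = dim U"
    using basis_exists[of U] by blast
  have "finite A"
    using independent_span_bound[OF F(1) A(2)] A(1) F(2) by blast
  then have "card B \<le> card A"
    using independent_span_bound[OF _ B(2)] B(1) A(3) by blast
  then show ?thesis using A(4) B(3) by simp
qed

lemma spanning_family_independent:
  assumes F: "finite F" "W \<subseteq> span F" "subspace W" and K: "finite K"
    and gen: "\<And>u. u \<in> U \<Longrightarrow> \<exists>c. u - (\<Sum>\<kappa>\<in>K. c \<kappa> *s b \<kappa>) \<in> W"
    and dim: "dim W + card K \<le> dim U"
    and rel: "(\<Sum>\<kappa>\<in>K. c \<kappa> *s b \<kappa>) \<in> W" and k: "k \<in> K"
  shows "c k = 0"
proof (rule ccontr)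
  assume ck: "c k \<noteq> 0"
  define r where "r = (\<Sum>\<kappa>\<in>K. c \<kappa> *s b \<kappa>)"
  have "\<exists>c. u - (\<Sum>\<kappa>\<in>K - {k}. c \<kappa> *s b \<kappa>) \<in> W" if u: "u \<in> U" for u
  proof -
    obtain x where x: "u - (\<Sum>\<kappa>\<in>K. x \<kappa> *s b \<kappa>) \<in> W" using gen u by blast
    \<comment> \<open>This multiple of the relation cancels the k-th coefficient of the
      representation of u.\<close>
    define s where "s = x k / c k"
    have "u - (\<Sum>\<kappa>\<in>K. x \<kappa> *s b \<kappa>) + s *s r \<in> W"
      using x rel F(3) by (simp add: r_def subspace_add subspace_scale)
    also have "u - (\<Sum>\<kappa>\<in>K. x \<kappa> *s b \<kappa>) + s *s r = u - (\<Sum>\<kappa>\<in>K. (x \<kappa> - s * c \<kappa>) *s b \<kappa>)"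
      by (simp add: r_def scale_sum_right scale_left_diff_distrib sum_subtractf)
    also have "(\<Sum>\<kappa>\<in>K. (x \<kappa> - s * c \<kappa>) *s b \<kappa>) = (\<Sum>\<kappa>\<in>K - {k}. (x \<kappa> - s * c \<kappa>) *s b \<kappa>)"
      using K k ck by (intro sum.mono_neutral_right) (auto simp: s_def)
    finally show ?thesis by (rule exI[of _ "\<lambda>\<kappa>. x \<kappa> - s * c \<kappa>"])
  qed
  then have "dim U \<le> dim W + card (K - {k})"
    using K by (intro dim_le_family[OF F(1,2)]) auto
  then show False
    using dim k K card_gt_0_iff[of K] by (auto simp: card_Diff_singleton)
qed

end

text \<open>Steinitz exchange: independent rows, together with the unit vectors indexed by a
  suitable E, form a basis of the space of all vectors indexed by I. Each new row replaces one unit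
  vector.\<close>

lemma exchange_rows:
  fixes a :: "'b \<Rightarrow> 'i \<Rightarrow> 'k::field"
  assumes "finite K" "finite I"
    and "\<And>x. \<forall>i\<in>I. (\<Sum>k\<in>K. x k * a k i) = 0 \<Longrightarrow> \<forall>k\<in>K. x k = 0"
  shows "\<exists>E\<subseteq>I. card E + card K = card I \<and>
    (\<forall>v. \<exists>y z. \<forall>j\<in>I. v j = (\<Sum>k\<in>K. y k * a k j) + (if j \<in> E then z j else 0))"
  using assms(1,3)
proof (induction K rule: finite_induct)
  case empty
  show ?case by (rule exI[of _ I]) auto
next
  case (insert k0 K)
  have upd: "(\<Sum>k\<in>insert k0 K. (y(k0 := s)) k * a k j) = s * a k0 j + (\<Sum>k\<in>K. y k * a k j)" for y s j
  proof -
    have "(\<Sum>k\<in>K. (y(k0 := s)) k * a k j) = (\<Sum>k\<in>K. y k * a k j)"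
      using insert.hyps by (intro sum.cong) auto
    then show ?thesis using insert.hyps by simp
  qed
  have ind: "\<forall>k\<in>K. x k = 0" if "\<forall>i\<in>I. (\<Sum>k\<in>K. x k * a k i) = 0" for x
  proof -
    have "\<forall>k\<in>insert k0 K. (x(k0 := 0)) k = 0"
      by (rule insert.prems) (use that in \<open>simp only: upd, simp\<close>)
    then show ?thesis using insert.hyps by (metis fun_upd_apply insertCI)
  qed
  then obtain E where E: "E \<subseteq> I" "card E + card K = card I"
      and gen: "\<And>v. \<exists>y z. \<forall>j\<in>I. v j = (\<Sum>k\<in>K. y k * a k j) + (if j \<in> E then z j else 0)"
    using insert.IH[OF ind] by blast
  obtain y0 z0 where a0: "\<And>j. j \<in> I \<Longrightarrow> a k0 j = (\<Sum>k\<in>K. y0 k * a k j) + (if j \<in> E then z0 j else 0)"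
    using gen[of "a k0"] by blast
  \<comment> \<open>If the new row had no component along E, it would be a combination of the
    earlier rows, against independence.\<close>
  obtain e where e: "e \<in> E" "z0 e \<noteq> 0"
  proof (rule ccontr)
    assume "\<not> thesis"
    then have z: "\<And>e. e \<in> E \<Longrightarrow> z0 e = 0" using that by blast
    have "\<forall>i\<in>I. (\<Sum>k\<in>insert k0 K. ((\<lambda>k. - y0 k)(k0 := 1)) k * a k i) = 0"
      unfolding upd using a0 z by (auto simp: sum_negf)
    then have "((\<lambda>k. - y0 k)(k0 := 1)) k0 = 0" using insert.prems by blast
    then show False by simp
  qed
  have fin: "finite E" using E(1) assms(2) finite_subset by blast
  show ?case
  proof (intro exI[of _ "E - {e}"] conjI allI)
    show "E - {e} \<subseteq> I" using E by blast
    have "card E > 0" using e fin card_gt_0_iff by blast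
    then show "card (E - {e}) + card (insert k0 K) = card I"
      using E(2) e fin insert.hyps by (simp add: card_Diff_singleton)
    fix v
    obtain y z where v: "\<And>j. j \<in> I \<Longrightarrow> v j = (\<Sum>k\<in>K. y k * a k j) + (if j \<in> E then z j else 0)"
      using gen[of v] by blast
    \<comment> \<open>Taking the new row s times absorbs the component of v along the removed unit
      vector e.\<close>
    define s where "s = z e / z0 e"
    show "\<exists>y z. \<forall>j\<in>I. v j = (\<Sum>k\<in>insert k0 K. y k * a k j) + (if j \<in> E - {e} then z j else 0)"
    proof (intro exI[of _ "(\<lambda>k. y k - s * y0 k)(k0 := s)"] exI[of _ "\<lambda>j. z j - s * z0 j"] ballI)
      fix j assume j: "j \<in> I"
      have "z e - s * z0 e = 0" using e by (simp add: s_def)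
      have ysum: "(\<Sum>k\<in>K. (y k - s * y0 k) * a k j) = (\<Sum>k\<in>K. y k * a k j) - s * (\<Sum>k\<in>K. y0 k * a k j)"
        by (simp add: left_diff_distrib sum_subtractf sum_distrib_left mult.assoc)
      have "(if j \<in> E - {e} then z j - s * z0 j else 0) =
          (if j \<in> E then z j else 0) - s * (if j \<in> E then z0 j else 0)"
        using \<open>z e - s * z0 e = 0\<close> by auto
      then show "v j = (\<Sum>k\<in>insert k0 K. ((\<lambda>k. y k - s * y0 k)(k0 := s)) k * a k j) +
          (if j \<in> E - {e} then z j - s * z0 j else 0)"
        unfolding upd using v[OF j] a0[OF j] ysum by (simp only: distrib_left) simp
    qed
  qed
qed

interpretation mp: vector_space "\<lambda>c p. const c * p :: 'k::field mpoly"
  by standard (simp_all add: const_add const_mult algebra_simps)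

subsection \<open>Counting monomials\<close>

definition monomials :: "nat \<Rightarrow> nat \<Rightarrow> (nat \<Rightarrow>\<^sub>0 nat) set" where
  "monomials m l = {t. keys t \<subseteq> {..m} \<and> mono_deg t = l}"

lemma monomials_zero: "monomials m 0 = {0}"
  by (auto simp: monomials_def)

lemma monomials_0: "monomials 0 l = {Poly_Mapping.single 0 l}"
proof -
  have "t = Poly_Mapping.single 0 (mono_deg t)" if "keys t \<subseteq> {..0}" for t
  proof (rule poly_mapping_eqI)
    fix i
    have "mono_deg t = lookup t 0" using mono_deg_superset[OF _ that] by simp
    then show "lookup t i = lookup (Poly_Mapping.single 0 (mono_deg t)) i"
      using that by (cases "i = 0") (auto simp: lookup_single_not_eq in_keys_iff)
  qed
  then show ?thesis by (auto simp: monomials_def split: if_splits)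
qed

text \<open>Division according to whether the last variable occurs; this is the combinatorial form
  of Pascal's rule behind \<open>card_monomials\<close>.\<close>

lemma monomials_Suc:
  "monomials (Suc m) (Suc l) =
     monomials m (Suc l) \<union> (\<lambda>t. t + Poly_Mapping.single (Suc m) 1) ` monomials (Suc m) l" (is "?L = ?R")
proof (intro Set.set_eqI iffI)
  fix t assume t: "t \<in> ?L"
  show "t \<in> ?R"
  proof (cases "Suc m \<in> keys t")
    case False
    then show ?thesis using t by (auto simp: monomials_def atMost_Suc)
  next
    case True
    define s where "s = t - Poly_Mapping.single (Suc m) 1"
    have ts: "t = s + Poly_Mapping.single (Suc m) 1"
      by (rule poly_mapping_eqI)
        (use True in \<open>auto simp: s_def lookup_add lookup_minus lookup_single when_def in_keys_iff\<close>)
    have "keys s \<subseteq> keys t"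
      by (auto simp: s_def in_keys_iff lookup_minus)
    moreover have "Suc (mono_deg s) = mono_deg t" by (simp add: ts mono_deg_add)
    ultimately have "s \<in> monomials (Suc m) l" using t by (auto simp: monomials_def)
    then show ?thesis using ts by blast
  qed
next
  fix t assume "t \<in> ?R"
  then show "t \<in> ?L"
  proof
    assume "t \<in> (\<lambda>t. t + Poly_Mapping.single (Suc m) 1) ` monomials (Suc m) l"
    then obtain s where s: "s \<in> monomials (Suc m) l" "t = s + Poly_Mapping.single (Suc m) 1" by blast
    have "keys t \<subseteq> keys s \<union> {Suc m}"
      using keys_add[of s "Poly_Mapping.single (Suc m) (1::nat)"] s(2) by simp
    then show ?thesis using s by (auto simp: monomials_def mono_deg_add)
  qed (auto simp: monomials_def atMost_Suc)
qed

lemma card_monomials: "finite (monomials m l) \<and> card (monomials m l) = (l + m choose m)"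
proof (induction "m + l" arbitrary: m l rule: less_induct)
  case less
  show ?case
  proof (cases m)
    case 0
    then show ?thesis by (simp add: monomials_0)
  next
    case m: (Suc m')
    show ?thesis
    proof (cases l)
      case 0
      then show ?thesis by (simp add: monomials_zero)
    next
      case l: (Suc l')
      let ?f = "\<lambda>t. t + Poly_Mapping.single (Suc m') (1::nat)"
      have 1: "finite (monomials m' l) \<and> card (monomials m' l) = (l + m' choose m')"
        using less[of m' l] m by simp
      have 2: "finite (monomials m l') \<and> card (monomials m l') = (l' + m choose m)"
        using less[of m l'] l by simp
      have "monomials m' l \<inter> ?f ` monomials m l' = {}"
      proof -
        have "Suc m' \<in> keys (?f t)" for t by (simp add: in_keys_iff lookup_add)
        then show ?thesis by (fastforce simp: monomials_def)
      qed
      moreover have "inj_on ?f (monomials m l')" by (auto intro: inj_onI)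
      ultimately have "card (monomials m l) = (l + m' choose m') + (l' + m choose m)"
        using 1 2 monomials_Suc[of m' l'] by (simp add: m l card_Un_disjoint card_image)
      also have "\<dots> = (l + m choose m)" by (simp add: m l)
      finally show ?thesis using 1 2 monomials_Suc[of m' l'] by (simp add: m l)
    qed
  qed
qed

lemma finite_monomials [simp]: "finite (monomials m l)"
  using card_monomials by blast

lemma homog_polys_iff: "p \<in> polys m \<and> homog l p \<longleftrightarrow> keys p \<subseteq> monomials m l"
  by (auto simp: polys_def homog_def monomials_def)

text \<open>Hilbert function of R_m[-q] in degree l. The case distinction stands for vanishing in
  negative degrees, which truncated subtraction would hide.\<close>

definition hilb :: "nat \<Rightarrow> nat \<Rightarrow> nat \<Rightarrow> nat" where
  "hilb m l q = (if q \<le> l then (l - q + m choose m) else 0)"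

definition hilb_sum :: "nat \<Rightarrow> nat \<Rightarrow> nat list \<Rightarrow> nat" where
  "hilb_sum m l qs = (\<Sum>i<length qs. hilb m l (qs ! i))"

text \<open>Index set of a k-basis of the degree-l part of the sum of the R_m[-q_i]: a summand and a
  monomial in it.\<close>

definition Ks :: "nat \<Rightarrow> nat \<Rightarrow> nat list \<Rightarrow> (nat \<times> (nat \<Rightarrow>\<^sub>0 nat)) set" where
  "Ks m l qs = (SIGMA i:{i. i < length qs \<and> qs ! i \<le> l}. monomials m (l - qs ! i))"

lemma finite_Ks [simp]: "finite (Ks m l qs)"
  by (simp add: Ks_def)

lemma card_Ks: "card (Ks m l qs) = hilb_sum m l qs"
proof -
  have "card (Ks m l qs) = (\<Sum>i | i < length qs \<and> qs ! i \<le> l. hilb m l (qs ! i))"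
    using card_monomials by (simp add: Ks_def hilb_def)
  also have "\<dots> = hilb_sum m l qs"
    unfolding hilb_sum_def by (rule sum.mono_neutral_left) (auto simp: hilb_def)
  finally show ?thesis .
qed

subsection \<open>Free homogeneous generators\<close>

definition deg_part :: "'k::field mpoly set \<Rightarrow> nat \<Rightarrow> 'k mpoly set" where
  "deg_part J l = {f \<in> J. homog l f}"

definition comb :: "'k::field mpoly list \<Rightarrow> nat list \<Rightarrow> (nat \<Rightarrow> 'k mpoly) \<Rightarrow> (nat \<Rightarrow> 'k mpoly) \<Rightarrow> 'k mpoly"
  where "comb Ys qs e v = (\<Sum>i<length qs. subst Ys (v i) * e i)"

text \<open>The same information as a graded isomorphism of J/I with
  \<open>shifted_sum m qs\<close>, but carried by polynomials that lift a homogeneous basis, so that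
  no cosets appear later. Generation is asked degree by degree, absence of relations for all
  vectors.\<close>

definition free_gens ::
    "nat \<Rightarrow> 'k::field mpoly set \<Rightarrow> 'k mpoly set \<Rightarrow> nat \<Rightarrow> 'k mpoly list \<Rightarrow> nat list
       \<Rightarrow> (nat \<Rightarrow> 'k mpoly) \<Rightarrow> bool" where
  "free_gens n J I m Ys qs e \<longleftrightarrow>
     (\<forall>i<length qs. e i \<in> deg_part J (qs ! i)) \<and>
     (\<forall>l. \<forall>f\<in>deg_part J l. \<exists>v\<in>grade (shifted_sum m qs) l. f - comb Ys qs e v \<in> I) \<and>
     (\<forall>v\<in>carrier (shifted_sum m qs). comb Ys qs e v \<in> I \<longrightarrow> v = (\<lambda>i. 0))"

lemma carrier_shifted_sum:
  "v \<in> carrier (shifted_sum m qs) \<longleftrightarrow>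
     (\<forall>i<length qs. v i \<in> polys m) \<and> (\<forall>i\<ge>length qs. v i = 0)"
  by (simp add: shifted_sum_def Let_def)

lemma grade_shifted_sum:
  "v \<in> grade (shifted_sum m qs) l \<longleftrightarrow> v \<in> carrier (shifted_sum m qs) \<and>
     (\<forall>i<length qs. if qs ! i \<le> l then homog (l - qs ! i) (v i) else v i = 0)"
  by (simp add: shifted_sum_def Let_def)

lemma shifted_sum_ops:
  "v \<oplus>\<^bsub>shifted_sum m qs\<^esub> w = (\<lambda>i. v i + w i)" "r \<odot>\<^bsub>shifted_sum m qs\<^esub> v = (\<lambda>i. r * v i)"
  by (simp_all add: shifted_sum_def Let_def)

lemma comb_add: "comb Ys qs e (\<lambda>i. v i + w i) = comb Ys qs e v + comb Ys qs e w"
  by (simp add: comb_def subst_simps distrib_right sum.distrib)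

lemma comb_diff: "comb Ys qs e (\<lambda>i. v i - w i) = comb Ys qs e v - comb Ys qs e w"
  by (simp add: comb_def subst_simps left_diff_distrib sum_subtractf)

lemma comb_mult: "comb Ys qs e (\<lambda>i. r * v i) = subst Ys r * comb Ys qs e v"
  by (simp add: comb_def subst_simps sum_distrib_left mult.assoc)

lemma comb_sum: "comb Ys qs e (\<lambda>i. \<Sum>a\<in>A. v a i) = (\<Sum>a\<in>A. comb Ys qs e (v a))"
  unfolding comb_def by (simp add: subst_sum sum_distrib_right) (rule sum.swap)

lemma ideal_polys_ideal: "ideal (polys n) (poly_ring n)"
  using PR.oneideal[of n] by simp

lemma subspace_deg_part: "ideal J (poly_ring n) \<Longrightarrow> mp.subspace (deg_part J l)"
  by (auto simp: mp.subspace_def deg_part_def intro: ideal_0 ideal_add homog_add ideal_mult homog_const_mult)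

context
  fixes n m :: nat and Ys :: "'k::field mpoly list" and qs :: "nat list"
  assumes Ys: "\<And>i. i \<le> m \<Longrightarrow> Ys ! i \<in> deg_part (polys n) 1"
begin

lemma Ys_polys: "i \<le> m \<Longrightarrow> Ys ! i \<in> polys n" and Ys_homog: "i \<le> m \<Longrightarrow> homog 1 (Ys ! i)"
  using Ys by (auto simp: deg_part_def)

lemma subst_polys: "r \<in> polys m \<Longrightarrow> subst Ys r \<in> polys n"
  using polys_subst Ys_polys by blast

lemma subst_homog: "r \<in> polys m \<Longrightarrow> homog l r \<Longrightarrow> homog l (subst Ys r)"
  using homog_subst_polys Ys_homog by blast

lemma comb_in_ideal:
  assumes "ideal J (poly_ring n)" "\<And>i. i < length qs \<Longrightarrow> e i \<in> J" "v \<in> carrier (shifted_sum m qs)"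
  shows "comb Ys qs e v \<in> J"
  unfolding comb_def
  by (rule ideal_sum[OF assms(1)], rule ideal_mult[OF assms(1)])
    (use assms(2,3) in \<open>auto simp: carrier_shifted_sum intro: subst_polys\<close>)

lemma comb_homog:
  assumes "\<And>i. i < length qs \<Longrightarrow> homog (qs ! i) (e i)" "v \<in> grade (shifted_sum m qs) l"
  shows "homog l (comb Ys qs e v)"
  unfolding comb_def
proof (rule homog_sum)
  fix i assume i: "i \<in> {..<length qs}"
  show "homog l (subst Ys (v i) * e i)"
  proof (cases "qs ! i \<le> l")
    case True
    then have "homog (l - qs ! i) (subst Ys (v i))"
      using assms(2) i by (intro subst_homog) (auto simp: grade_shifted_sum carrier_shifted_sum)
    then show ?thesis using homog_mult[OF _ assms(1)[of i]] i True by fastforce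
  next
    case False
    then show ?thesis using assms(2) i by (auto simp: grade_shifted_sum)
  qed
qed

lemma hc_subst:
  assumes "r \<in> polys m"
  shows "hc l (subst Ys r) = subst Ys (hc l r)"
proof -
  obtain N where N: "\<And>M. M \<ge> N \<Longrightarrow> r = (\<Sum>j\<le>M. hc j r)" using hc_expand[of r] by blast
  have "subst Ys r = (\<Sum>j\<le>N + l. subst Ys (hc j r))"
    using N[of "N + l"] by (metis le_add1 subst_sum)
  then have "hc l (subst Ys r) = (\<Sum>j\<le>N + l. hc l (subst Ys (hc j r)))"
    by (simp add: hc_sum)
  also have "\<dots> = (\<Sum>j\<le>N + l. if j = l then subst Ys (hc j r) else 0)"
    using hc_homog[OF subst_homog[OF polys_hc[OF assms] homog_hc]] by (intro sum.cong) auto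
  finally show ?thesis by simp
qed

text \<open>Every homogeneous component of a relation is again a relation, because I contains the
  components of its elements.\<close>

lemma free_if_free_homog:
  assumes I: "homog_ideal n I"
    and e: "\<And>i. i < length qs \<Longrightarrow> homog (qs ! i) (e i)"
    and uniq: "\<And>l v. v \<in> grade (shifted_sum m qs) l \<Longrightarrow> comb Ys qs e v \<in> I \<Longrightarrow> v = (\<lambda>i. 0)"
    and v: "v \<in> carrier (shifted_sum m qs)" "comb Ys qs e v \<in> I"
  shows "v = (\<lambda>i. 0)"
proof -
  \<comment> \<open>The component of v of degree l for the shifted grading: coordinate i contributes
    in degree l - q_i.\<close>
  define w where "w = (\<lambda>l i. if i < length qs \<and> qs ! i \<le> l then hc (l - qs ! i) (v i) else 0)"
  have "hc l (comb Ys qs e v) = comb Ys qs e (w l)" for l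
    unfolding comb_def hc_sum
  proof (rule sum.cong)
    fix i assume i: "i \<in> {..<length qs}"
    then have "v i \<in> polys m" using v by (simp add: carrier_shifted_sum)
    then show "hc l (subst Ys (v i) * e i) = subst Ys (w l i) * e i"
      using hc_mult_homog[OF e[of i]] i by (simp add: w_def hc_subst)
  qed simp
  then have "comb Ys qs e (w l) \<in> I" for l
    using homog_ideal_hc[OF I v(2)] by metis
  moreover have "w l \<in> grade (shifted_sum m qs) l" for l
    using v(1) by (auto simp: grade_shifted_sum carrier_shifted_sum w_def polys_hc)
  ultimately have w0: "w l = (\<lambda>i. 0)" for l using uniq by blast
  show ?thesis
  proof
    fix i
    show "v i = 0"
    proof (cases "i < length qs")
      case True
      have "hc l (v i) = 0" for l
        using fun_cong[OF w0[of "l + qs ! i"], of i] True by (simp add: w_def)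
      then show ?thesis by (rule hc_eq_0_imp)
    next
      case False
      then show ?thesis using v(1) by (simp add: carrier_shifted_sum)
    qed
  qed
qed

subsection \<open>Graded isomorphisms\<close>

text \<open>The coordinate ring is the case J = A_n of the relative module, so one translation to
  \<open>free_gens\<close> serves for both kinds of characteristic sequence.\<close>

lemma coord_module_eq_rel_ideal_module:
  assumes "ideal I (poly_ring n)"
  shows "coord_module n I Ys = rel_ideal_module n I Ys (polys n)"
proof -
  have "coord_grade n I l = residue n I ` polys n \<inter> coord_grade n I l" for l
    by (auto simp: coord_grade_def)
  then show ?thesis
    using coord_ring_simps(1)[OF assms] by (simp add: rel_ideal_module_def coord_module_def)
qed

text \<open>The generators are representatives of the preimages of the unit vectors. By linearity h
  sends the class of \<open>comb Ys qs e v\<close> back to v, and generation and freeness follow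
  from bijectivity.\<close>

lemma free_gens_if_graded_iso:
  assumes I: "ideal I (poly_ring n)" and J: "ideal J (poly_ring n)" and IJ: "I \<subseteq> J"
    and iso: "graded_iso (poly_ring m) (rel_ideal_module n I Ys J) (shifted_sum m qs)"
  shows "\<exists>e. free_gens n J I m Ys qs e"
proof -
  let ?N = "shifted_sum m qs"
  let ?res = "residue n I"
  note cr = coord_ring_simps[OF I]
  obtain h where bij: "bij_betw h (?res ` J) (carrier ?N)"
    and add0: "\<forall>x\<in>J. \<forall>y\<in>J. h (?res x \<oplus>\<^bsub>coord_ring n I\<^esub> ?res y) = (\<lambda>i. h (?res x) i + h (?res y) i)"
    and smult0: "\<forall>r\<in>polys m. \<forall>x\<in>J.
        h (?res (subst Ys r) \<otimes>\<^bsub>coord_ring n I\<^esub> ?res x) = (\<lambda>i. r * h (?res x) i)"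
    and gr: "\<And>l. h ` (?res ` J \<inter> coord_grade n I l) = grade ?N l"
    using iso
    by (auto simp: graded_iso_def rel_ideal_module_def coord_module_def shifted_sum_ops)
  have Jp: "f \<in> polys n" if "f \<in> J" for f using ideal_polys[OF J that] .
  have add: "h (?res (f + g)) = (\<lambda>i. h (?res f) i + h (?res g) i)" if "f \<in> J" "g \<in> J" for f g
    using add0 that by (simp add: cr Jp)
  have smult: "h (?res (subst Ys r * f)) = (\<lambda>i. r * h (?res f) i)" if "r \<in> polys m" "f \<in> J" for r f
    using smult0 that by (simp add: cr Jp subst_polys)
  have zero: "h (?res 0) = (\<lambda>i. 0)"
    using smult[of 0 0] by (simp add: ideal_0[OF J])
  have inj: "f - g \<in> I" if "f \<in> J" "g \<in> J" "h (?res f) = h (?res g)" for f g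
    using bij that residue_eq_iff[OF I Jp[OF that(1)] Jp[OF that(2)]]
    by (auto simp: bij_betw_def dest: inj_onD)
  define u where "u = (\<lambda>i j :: nat. if j = i then 1 else (0 :: 'k mpoly))"
  have "\<exists>f\<in>deg_part J (qs ! i). h (?res f) = u i" if i: "i < length qs" for i
  proof -
    have "u i \<in> grade ?N (qs ! i)"
      using i by (auto simp: grade_shifted_sum carrier_shifted_sum u_def)
    then have "u i \<in> h ` (?res ` J \<inter> coord_grade n I (qs ! i))" by (simp add: gr)
    then obtain x where hx: "u i = h x" and x_in: "x \<in> ?res ` J \<inter> coord_grade n I (qs ! i)"
      by (rule imageE)
    have x: "x \<in> ?res ` J" "x \<in> coord_grade n I (qs ! i)" "h x = u i"
      using hx x_in by simp_all
    obtain f where f: "f \<in> J" "x = ?res f" using x by blast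
    obtain g where g: "g \<in> polys n" "homog (qs ! i) g" "x = ?res g"
      using x by (auto simp: coord_grade_def)
    \<comment> \<open>The representative f lies in J, the representative g is homogeneous. As they
      differ by an element of I, contained in J, g has both properties.\<close>
    have "g - f \<in> I" using f g residue_eq_iff[OF I g(1) Jp[OF f(1)]] by simp
    then have "g - f + f \<in> J" using IJ f ideal_add[OF J] by blast
    then show ?thesis using g x(3) by (auto simp: deg_part_def)
  qed
  then obtain e where e: "\<And>i. i < length qs \<Longrightarrow> e i \<in> deg_part J (qs ! i)"
      "\<And>i. i < length qs \<Longrightarrow> h (?res (e i)) = u i"
    by metis
  have eJ: "e i \<in> J" if "i < length qs" for i using e(1)[OF that] by (simp add: deg_part_def)
  have h_comb: "h (?res (comb Ys qs e v)) = v" if v: "v \<in> carrier ?N" for v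
  proof -
    have "h (?res (\<Sum>i\<in>A. subst Ys (v i) * e i)) = (\<lambda>i. if i \<in> A then v i else 0)"
      if "finite A" "A \<subseteq> {..<length qs}" for A
      using that
    proof (induction A rule: finite_induct)
      case empty
      then show ?case by (simp add: zero)
    next
      case (insert a A)
      have vp: "v i \<in> polys m" if "i < length qs" for i
        using v that by (simp add: carrier_shifted_sum)
      have "subst Ys (v i) * e i \<in> J" if "i < length qs" for i
        using ideal_mult[OF J eJ[OF that] subst_polys[OF vp[OF that]]] .
      then have "h (?res (subst Ys (v a) * e a + (\<Sum>i\<in>A. subst Ys (v i) * e i))) =
          (\<lambda>i. h (?res (subst Ys (v a) * e a)) i + h (?res (\<Sum>i\<in>A. subst Ys (v i) * e i)) i)"
        using insert.prems by (intro add ideal_sum[OF J]) auto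
      also have "\<dots> = (\<lambda>i. v a * u a i + (if i \<in> A then v i else 0))"
        using insert vp eJ e(2) by (simp add: smult)
      also have "\<dots> = (\<lambda>i. if i \<in> insert a A then v i else 0)"
        using insert.hyps by (auto simp: u_def)
      finally show ?case using insert.hyps by simp
    qed
    from this[of "{..<length qs}"] show ?thesis
      using v by (auto simp: comb_def fun_eq_iff carrier_shifted_sum)
  qed
  have cJ: "comb Ys qs e v \<in> J" if "v \<in> carrier ?N" for v
    by (rule comb_in_ideal[OF J]) (use eJ that in auto)
  have "\<exists>v\<in>grade ?N l. f - comb Ys qs e v \<in> I" if f: "f \<in> deg_part J l" for f l
  proof
    have fJ: "f \<in> J" using f by (simp add: deg_part_def)
    then have "?res f \<in> ?res ` J \<inter> coord_grade n I l"
      using f by (auto simp: deg_part_def coord_grade_def Jp)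
    then show v: "h (?res f) \<in> grade ?N l" using gr by blast
    then have "h (?res f) \<in> carrier ?N" by (simp add: grade_shifted_sum)
    then show "f - comb Ys qs e (h (?res f)) \<in> I"
      using inj[OF fJ cJ] h_comb by simp
  qed
  moreover have "v = (\<lambda>i. 0)" if "v \<in> carrier ?N" "comb Ys qs e v \<in> I" for v
  proof -
    have "?res (comb Ys qs e v) = ?res 0"
      using residue_eq_iff[OF I Jp[OF cJ[OF that(1)]], of 0] that(2) by simp
    then show ?thesis using h_comb[OF that(1)] zero by simp
  qed
  ultimately show ?thesis using e(1) unfolding free_gens_def by blast
qed

lemma graded_iso_if_free_gens:
  assumes I: "homog_ideal n I" and fg: "free_gens n (polys n) I m Ys qs e"
  shows "graded_iso (poly_ring m) (coord_module n I Ys) (shifted_sum m qs)"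
proof -
  let ?N = "shifted_sum m qs"
  let ?res = "residue n I"
  let ?g = "\<lambda>v. ?res (comb Ys qs e v)"
  have idI: "ideal I (poly_ring n)" using I by (simp add: homog_ideal_def)
  note cr = coord_ring_simps[OF idI]
  have e: "e i \<in> polys n" "homog (qs ! i) (e i)" if "i < length qs" for i
    using fg that by (auto simp: free_gens_def deg_part_def)
  have gen: "\<exists>v\<in>grade ?N l. f - comb Ys qs e v \<in> I" if "f \<in> polys n" "homog l f" for f l
    using fg that by (auto simp: free_gens_def deg_part_def)
  have cp: "comb Ys qs e v \<in> polys n" if "v \<in> carrier ?N" for v
    by (rule comb_in_ideal[OF ideal_polys_ideal]) (use e that in auto)
  have ginj: "inj_on ?g (carrier ?N)"
  proof (rule inj_onI)
    fix v w assume v: "v \<in> carrier ?N" "w \<in> carrier ?N" "?g v = ?g w"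
    then have "comb Ys qs e (\<lambda>i. v i - w i) \<in> I"
      using residue_eq_iff[OF idI cp[OF v(1)] cp[OF v(2)]] by (simp add: comb_diff)
    moreover have "(\<lambda>i. v i - w i) \<in> carrier ?N"
      using v by (simp add: carrier_shifted_sum polys_diff)
    ultimately have "(\<lambda>i. v i - w i) = (\<lambda>i. 0)"
      using fg by (auto simp: free_gens_def)
    then show "v = w" by (auto simp: fun_eq_iff)
  qed
  have gsurj: "?g ` carrier ?N = ?res ` polys n"
  proof
    show "?g ` carrier ?N \<subseteq> ?res ` polys n" using cp by blast
    show "?res ` polys n \<subseteq> ?g ` carrier ?N"
    proof
      fix x assume "x \<in> ?res ` polys n"
      then obtain f where f: "f \<in> polys n" "x = ?res f" by blast
      \<comment> \<open>Generation is available only for homogeneous elements, so f is treated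
        component by component and the coefficient vectors are added.\<close>
      obtain N where N: "f = (\<Sum>l\<le>N. hc l f)" using hc_expand[of f] by blast
      obtain v where v: "\<And>l. v l \<in> grade ?N l" "\<And>l. hc l f - comb Ys qs e (v l) \<in> I"
        using gen[OF polys_hc[OF f(1)] homog_hc] by metis
      define w where "w = (\<lambda>i. \<Sum>l\<le>N. v l i)"
      have w: "w \<in> carrier ?N"
        using v(1) by (auto simp: w_def grade_shifted_sum carrier_shifted_sum intro: polys_sum)
      have "f - comb Ys qs e w = (\<Sum>l\<le>N. hc l f - comb Ys qs e (v l))"
        using N by (simp add: w_def comb_sum sum_subtractf)
      also have "\<dots> \<in> I" by (rule ideal_sum[OF idI v(2)])
      finally have "?res f = ?g w" using residue_eq_iff[OF idI f(1) cp[OF w]] by simp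
      then show "x \<in> ?g ` carrier ?N" using f w by blast
    qed
  qed
  have ggr: "?g ` grade ?N l = coord_grade n I l" for l
  proof
    show "?g ` grade ?N l \<subseteq> coord_grade n I l"
    proof
      fix x assume "x \<in> ?g ` grade ?N l"
      then obtain v where v: "v \<in> grade ?N l" "x = ?g v" by blast
      have "homog l (comb Ys qs e v)" using comb_homog[OF e(2) v(1)] by blast
      moreover have "comb Ys qs e v \<in> polys n" using cp v by (simp add: grade_shifted_sum)
      ultimately show "x \<in> coord_grade n I l" using v by (auto simp: coord_grade_def)
    qed
    show "coord_grade n I l \<subseteq> ?g ` grade ?N l"
    proof
      fix x assume "x \<in> coord_grade n I l"
      then obtain f where f: "f \<in> polys n" "homog l f" "x = ?res f" by (auto simp: coord_grade_def)
      then obtain v where v: "v \<in> grade ?N l" "f - comb Ys qs e v \<in> I" using gen by blast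
      then have "?res f = ?g v"
        using residue_eq_iff[OF idI f(1) cp] by (auto simp: grade_shifted_sum)
      then show "x \<in> ?g ` grade ?N l" using f v by blast
    qed
  qed
  \<comment> \<open>\<open>graded_iso\<close> asks for a map out of the coordinate module, so the
    bijection given by \<open>comb\<close> has to be inverted.\<close>
  define h where "h = inv_into (carrier ?N) ?g"
  have hg: "h (?g v) = v" if "v \<in> carrier ?N" for v
    unfolding h_def using ginj that by (rule inv_into_f_f)
  have sub: "grade ?N l \<subseteq> carrier ?N" for l by (auto simp: grade_shifted_sum)
  show ?thesis
    unfolding graded_iso_def
  proof (intro exI[of _ h] conjI ballI allI)
    show "bij_betw h (carrier (coord_module n I Ys)) (carrier ?N)"
      using bij_betw_inv_into[of ?g "carrier ?N"] ginj gsurj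
      by (simp add: bij_betw_def coord_module_def cr h_def)
    fix x y assume "x \<in> carrier (coord_module n I Ys)"
    then obtain v where v: "v \<in> carrier ?N" "x = ?g v"
      using gsurj unfolding coord_module_def by (simp add: cr) blast
    {
      assume "y \<in> carrier (coord_module n I Ys)"
      then obtain w where w: "w \<in> carrier ?N" "y = ?g w"
        using gsurj unfolding coord_module_def by (simp add: cr) blast
      have "(\<lambda>i. v i + w i) \<in> carrier ?N"
        using v w by (simp add: carrier_shifted_sum polys_add)
      then show "h (x \<oplus>\<^bsub>coord_module n I Ys\<^esub> y) = h x \<oplus>\<^bsub>?N\<^esub> h y"
        using hg[of "\<lambda>i. v i + w i"] v w
        by (simp add: coord_module_def cr cp hg shifted_sum_ops comb_add)
    }
    fix r :: "'k mpoly" assume r: "r \<in> carrier (poly_ring m)"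
    then have "(\<lambda>i. r * v i) \<in> carrier ?N"
      using v by (simp add: carrier_shifted_sum polys_mult)
    then show "h (r \<odot>\<^bsub>coord_module n I Ys\<^esub> x) = r \<odot>\<^bsub>?N\<^esub> h x"
      using hg[of "\<lambda>i. r * v i"] v r
      by (simp add: coord_module_def cr cp hg shifted_sum_ops comb_mult subst_polys)
  next
    fix l
    have "h ` ?g ` grade ?N l = grade ?N l"
      unfolding image_image using hg sub by (force simp: image_iff)
    then show "h ` grade (coord_module n I Ys) l = grade ?N l"
      by (simp add: ggr coord_module_def)
  qed
qed

end

subsection \<open>Hilbert functions\<close>

definition bf :: "'k::field mpoly list \<Rightarrow> (nat \<Rightarrow> 'k mpoly) \<Rightarrow> nat \<times> (nat \<Rightarrow>\<^sub>0 nat) \<Rightarrow> 'k mpoly" where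
  "bf Ys e \<kappa> = mval ((!) Ys) (snd \<kappa>) * e (fst \<kappa>)"

lemma grade_keys:
  assumes "v \<in> grade (shifted_sum m qs) l" "i < length qs" "qs ! i \<le> l"
  shows "keys (v i) \<subseteq> monomials m (l - qs ! i)"
  using assms homog_polys_iff[of "v i" m "l - qs ! i"]
  by (auto simp: grade_shifted_sum carrier_shifted_sum)

text \<open>Passage from modules to vector spaces: in degree l an R_m-combination of the generators
  is a k-linear combination of the finite family \<open>bf\<close>, its coefficients being those of
  the polynomials \<open>v i\<close>.\<close>

lemma comb_grade:
  assumes v: "v \<in> grade (shifted_sum m qs) l"
  shows "comb Ys qs e v = (\<Sum>\<kappa>\<in>Ks m l qs. const (lookup (v (fst \<kappa>)) (snd \<kappa>)) * bf Ys e \<kappa>)"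
proof -
  have "comb Ys qs e v = (\<Sum>i | i < length qs \<and> qs ! i \<le> l. subst Ys (v i) * e i)"
    unfolding comb_def
    by (rule sum.mono_neutral_right) (use v in \<open>auto simp: grade_shifted_sum not_le\<close>)
  also have "\<dots> = (\<Sum>i | i < length qs \<and> qs ! i \<le> l.
      \<Sum>t\<in>monomials m (l - qs ! i). const (lookup (v i) t) * bf Ys e (i, t))"
  proof (rule sum.cong)
    fix i assume "i \<in> {i. i < length qs \<and> qs ! i \<le> l}"
    then have "keys (v i) \<subseteq> monomials m (l - qs ! i)" using grade_keys[OF v] by simp
    then have "subst Ys (v i) = (\<Sum>t\<in>monomials m (l - qs ! i). const (lookup (v i) t) * mval ((!) Ys) t)"
      by (simp add: subst_eq_ev sb.ev_superset)
    then show "subst Ys (v i) * e i = (\<Sum>t\<in>monomials m (l - qs ! i). const (lookup (v i) t) * bf Ys e (i, t))"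
      by (simp add: sum_distrib_right bf_def mult.assoc)
  qed simp
  also have "\<dots> = (\<Sum>\<kappa>\<in>Ks m l qs. const (lookup (v (fst \<kappa>)) (snd \<kappa>)) * bf Ys e \<kappa>)"
    unfolding Ks_def by (subst sum.Sigma) (auto simp: case_prod_beta)
  finally show ?thesis .
qed

text \<open>Together with \<open>grade_eq_0\<close> this identifies the degree-l part of the free
  module with the scalar families on \<open>Ks m l qs\<close>.\<close>

lemma grade_of_coeffs:
  "\<exists>v\<in>grade (shifted_sum m qs) l. \<forall>\<kappa>\<in>Ks m l qs. lookup (v (fst \<kappa>)) (snd \<kappa>) = (c \<kappa> :: 'k::field)"
proof -
  define v where "v = (\<lambda>i. if i < length qs \<and> qs ! i \<le> l
      then \<Sum>t\<in>monomials m (l - qs ! i). mterm t (c (i, t)) else 0)"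
  have lv: "lookup (v i) s = (if i < length qs \<and> qs ! i \<le> l \<and> s \<in> monomials m (l - qs ! i) then c (i, s) else 0)"
    for i s
    by (simp add: v_def lookup_sum lookup_single when_def sum.delta)
  have 1: "v i \<in> polys m \<and> homog (l - qs ! i) (v i)" for i
    by (auto simp: homog_polys_iff in_keys_iff lv split: if_splits)
  have 2: "\<not> (i < length qs \<and> qs ! i \<le> l) \<Longrightarrow> v i = 0" for i
    by (auto simp: v_def)
  have "v \<in> grade (shifted_sum m qs) l"
    using 1 2 by (simp add: grade_shifted_sum carrier_shifted_sum)
  moreover have "\<forall>\<kappa>\<in>Ks m l qs. lookup (v (fst \<kappa>)) (snd \<kappa>) = c \<kappa>"
    by (auto simp: Ks_def lv)
  ultimately show ?thesis by blast
qed

lemma grade_eq_0: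
  assumes v: "v \<in> grade (shifted_sum m qs) l"
    and 0: "\<forall>\<kappa>\<in>Ks m l qs. lookup (v (fst \<kappa>)) (snd \<kappa>) = 0"
  shows "v = (\<lambda>i. 0)"
proof
  fix i
  show "v i = 0"
  proof (cases "i < length qs \<and> qs ! i \<le> l")
    case True
    show ?thesis
    proof (rule poly_mapping_eqI)
      fix t
      have "t \<in> keys (v i) \<Longrightarrow> lookup (v i) t = 0"
        using grade_keys[OF v, of i] True 0 by (auto simp: Ks_def)
      then show "lookup (v i) t = lookup 0 t" by (auto simp: in_keys_iff)
    qed
  next
    case False
    then show ?thesis using v by (cases "i < length qs") (auto simp: grade_shifted_sum carrier_shifted_sum)
  qed
qed

lemma deg_part_polys_span: "deg_part (polys n) l \<subseteq> mp.span ((\<lambda>t. mterm t 1) ` monomials n l)"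
proof
  fix p :: "'k::field mpoly" assume "p \<in> deg_part (polys n) l"
  then have "keys p \<subseteq> monomials n l" using homog_polys_iff[of p n l] by (simp add: deg_part_def)
  then have "(\<Sum>t\<in>keys p. const (lookup p t) * mterm t 1) \<in> mp.span ((\<lambda>t. mterm t 1) ` monomials n l)"
    by (intro mp.span_sum mp.span_scale mp.span_base) auto
  also have "(\<Sum>t\<in>keys p. const (lookup p t) * mterm t 1) = p"
    using mpoly_sum_single[of p] by (simp add: const_def mult_single)
  finally show "p \<in> mp.span ((\<lambda>t. mterm t 1) ` monomials n l)" .
qed

lemma deg_part_mono: "I \<subseteq> J \<Longrightarrow> deg_part I l \<subseteq> deg_part J l"
  by (auto simp: deg_part_def)

lemma bf_in_deg_part:
  assumes Ys: "\<And>i. i \<le> m \<Longrightarrow> Ys ! i \<in> deg_part (polys n) 1"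
    and J: "ideal J (poly_ring n)"
    and e: "\<And>i. i < length qs \<Longrightarrow> e i \<in> deg_part J (qs ! i)"
    and \<kappa>: "\<kappa> \<in> Ks m l qs"
  shows "bf Ys e \<kappa> \<in> deg_part J l"
proof -
  obtain i t where it: "\<kappa> = (i, t)" "i < length qs" "qs ! i \<le> l" "t \<in> monomials m (l - qs ! i)"
    using \<kappa> by (auto simp: Ks_def)
  have "mterm t (1::'a) \<in> polys m" "homog (l - qs ! i) (mterm t (1::'a))"
    using it(4) by (auto simp: monomials_def polys_single)
  then have "mval ((!) Ys) t \<in> polys n" "homog (l - qs ! i) (mval ((!) Ys) t)"
    using subst_polys[OF Ys, where r = "mterm t 1"] subst_homog[OF Ys, where r = "mterm t 1"]
    by simp_all
  then show ?thesis
    using e[OF it(2)] it homog_mult[of "l - qs ! i" "mval ((!) Ys) t" "qs ! i" "e i"]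
    by (auto simp: deg_part_def bf_def intro: ideal_mult[OF J])
qed

text \<open>The family \<open>bf\<close> induces a basis of the degree-l part of J/I: generation
  bounds the dimension from above, freeness from below.\<close>

lemma free_gens_dim:
  assumes Ys: "\<And>i. i \<le> m \<Longrightarrow> Ys ! i \<in> deg_part (polys n) 1"
    and I: "ideal I (poly_ring n)" and J: "ideal J (poly_ring n)" and IJ: "I \<subseteq> J"
    and fg: "free_gens n J I m Ys qs e"
  shows "mp.dim (deg_part J l) = mp.dim (deg_part I l) + hilb_sum m l qs"
proof (rule antisym)
  let ?F = "(\<lambda>t. mterm t (1::'a)) ` monomials n l"
  have span: "deg_part J l \<subseteq> mp.span ?F" "deg_part I l \<subseteq> mp.span ?F"
    using deg_part_polys_span[of n l] ideal_polys[OF J] ideal_polys[OF I]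
    by (auto simp: deg_part_def)
  have e: "\<And>i. i < length qs \<Longrightarrow> e i \<in> deg_part J (qs ! i)"
    using fg by (auto simp: free_gens_def)
  note b = bf_in_deg_part[OF Ys J e]
  have "\<exists>c. u - (\<Sum>\<kappa>\<in>Ks m l qs. const (c \<kappa>) * bf Ys e \<kappa>) \<in> deg_part I l"
    if u: "u \<in> deg_part J l" for u
  proof -
    obtain v where v: "v \<in> grade (shifted_sum m qs) l" "u - comb Ys qs e v \<in> I"
      using fg u unfolding free_gens_def by blast
    have "homog l (comb Ys qs e v)"
      by (rule comb_homog[OF Ys _ v(1)]) (use e in \<open>auto simp: deg_part_def\<close>)
    then have "u - comb Ys qs e v \<in> deg_part I l"
      using u v(2) by (auto simp: deg_part_def intro: homog_diff)
    then show ?thesis unfolding comb_grade[OF v(1)]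
        by (rule exI[where x = "\<lambda>\<kappa>. lookup (v (fst \<kappa>)) (snd \<kappa>)"])
  qed
  then have "mp.dim (deg_part J l) \<le> mp.dim (deg_part I l) + card (Ks m l qs)"
    using span by (intro mp.dim_le_family[of ?F]) auto
  then show "mp.dim (deg_part J l) \<le> mp.dim (deg_part I l) + hilb_sum m l qs"
    by (simp add: card_Ks)
  have ind: "\<forall>\<kappa>\<in>Ks m l qs. c \<kappa> = 0"
    if c: "(\<Sum>\<kappa>\<in>Ks m l qs. const (c \<kappa>) * bf Ys e \<kappa>) \<in> deg_part I l" for c
  proof -
    obtain v where v: "v \<in> grade (shifted_sum m qs) l"
        "\<forall>\<kappa>\<in>Ks m l qs. lookup (v (fst \<kappa>)) (snd \<kappa>) = c \<kappa>"
      using grade_of_coeffs by blast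
    have "comb Ys qs e v \<in> I"
      using c v(2) by (simp add: comb_grade[OF v(1)] deg_part_def)
    then have "v = (\<lambda>i. 0)" using fg v(1) by (auto simp: free_gens_def grade_shifted_sum)
    then show ?thesis using v(2) by auto
  qed
  have "mp.dim (deg_part I l) + card (Ks m l qs) \<le> mp.dim (deg_part J l)"
    by (rule mp.dim_ge_family[OF _ span(1) subspace_deg_part[OF I] deg_part_mono[OF IJ] finite_Ks b ind]) auto
  then show "mp.dim (deg_part I l) + hilb_sum m l qs \<le> mp.dim (deg_part J l)"
    by (simp add: card_Ks)
qed

text \<open>Generators whose number in each degree does not exceed what the Hilbert function allows
  admit no homogeneous relation, hence no relation at all.\<close>

lemma free_gens_if_dim:
  fixes I :: "'k::field mpoly set"
  assumes Ys: "\<And>i. i \<le> m \<Longrightarrow> Ys ! i \<in> deg_part (polys n) 1"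
    and hI: "homog_ideal n I"
    and e: "\<And>i. i < length qs \<Longrightarrow> e i \<in> deg_part (polys n) (qs ! i)"
    and gen: "\<And>l f. f \<in> deg_part (polys n) l \<Longrightarrow> \<exists>v\<in>grade (shifted_sum m qs) l. f - comb Ys qs e v \<in> I"
    and dim: "\<And>l. mp.dim (deg_part I l) + hilb_sum m l qs \<le> mp.dim (deg_part (polys n :: 'k mpoly set) l)"
  shows "free_gens n (polys n) I m Ys qs e"
proof -
  have I: "ideal I (poly_ring n)" using hI by (simp add: homog_ideal_def)
  have eh: "\<And>i. i < length qs \<Longrightarrow> homog (qs ! i) (e i)" using e by (simp add: deg_part_def)
  have "v = (\<lambda>i. 0)" if v: "v \<in> grade (shifted_sum m qs) l" "comb Ys qs e v \<in> I" for v l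
  proof (rule grade_eq_0[OF v(1)], rule ballI)
    fix \<kappa> assume \<kappa>: "\<kappa> \<in> Ks m l qs"
    let ?F = "(\<lambda>t. mterm t (1::'k)) ` monomials n l"
    have "deg_part I l \<subseteq> deg_part (polys n) l" using ideal_polys[OF I] by (auto simp: deg_part_def)
    then have span: "deg_part I l \<subseteq> mp.span ?F" using deg_part_polys_span[of n l] by blast
    have c: "comb Ys qs e v \<in> deg_part I l"
      using v comb_homog[OF Ys eh v(1)] by (simp add: deg_part_def)
    have gen': "\<exists>c. u - (\<Sum>\<kappa>\<in>Ks m l qs. const (c \<kappa>) * bf Ys e \<kappa>) \<in> deg_part I l"
      if u: "u \<in> deg_part (polys n) l" for u
    proof -
      obtain v where v: "v \<in> grade (shifted_sum m qs) l" "u - comb Ys qs e v \<in> I"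
        using gen[OF u] by blast
      have "u - comb Ys qs e v \<in> deg_part I l"
        using u v(2) comb_homog[OF Ys eh v(1)] by (auto simp: deg_part_def intro: homog_diff)
      then show ?thesis unfolding comb_grade[OF v(1)]
        by (rule exI[where x = "\<lambda>\<kappa>. lookup (v (fst \<kappa>)) (snd \<kappa>)"])
    qed
    show "lookup (v (fst \<kappa>)) (snd \<kappa>) = 0"
      by (rule mp.spanning_family_independent[OF _ span subspace_deg_part[OF I] finite_Ks gen' _ _ \<kappa>])
        (use dim[of l] c in \<open>auto simp: card_Ks comb_grade[OF v(1)]\<close>)
  qed
  then show ?thesis
    unfolding free_gens_def using e gen free_if_free_homog[OF Ys hI eh] by blast
qed

subsection \<open>The Hilbert polynomial\<close>

context
  fixes n :: nat and I :: "'k::field mpoly set"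
  assumes I: "ideal I (poly_ring n)" and proper: "1 \<notin> I"
begin

interpretation A: cring "coord_ring n I"
  by (rule cring_coord_ring[OF I])

lemma const_in_ideal: "const c \<in> I \<Longrightarrow> c = 0"
proof (rule ccontr)
  assume "const c \<in> I" "c \<noteq> 0"
  then have "const (inverse c) * const c \<in> I" by (intro ideal_mult[OF I]) auto
  then show False using proper \<open>c \<noteq> 0\<close> by (simp flip: const_mult)
qed

text \<open>Scalars embed into A_n/I because 1 is not in I. Their image is the field over which
  \<open>hilbert_fun\<close> measures dimension.\<close>

lemma subfield_constants: "subfield (range (\<lambda>c. residue n I (const c))) (coord_ring n I)"
proof -
  let ?K = "range (\<lambda>c. residue n I (const c))"
  note cr = coord_ring_simps[OF I]
  have eq: "residue n I (const a) = residue n I (const b) \<longleftrightarrow> a = b" for a b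
    using residue_eq_iff[OF I, of "const a" "const b"] const_in_ideal[of "a - b"] ideal_0[OF I]
    by (auto simp: const_minus)
  have inv: "\<ominus>\<^bsub>coord_ring n I\<^esub> residue n I (const c) = residue n I (const (- c))" for c
    by (rule A.minus_equality) (auto simp: cr simp flip: const_add)
  have "subring ?K (coord_ring n I)"
    by (rule A.subringI)
      (auto simp: cr inv simp flip: const_mult const_add const_1 intro: image_eqI[of _ _ "1::'k"])
  then have "subcring ?K (coord_ring n I)"
    by (rule A.subcringI')
  then show ?thesis
  proof (rule A.subfieldI)
    show "Units (coord_ring n I\<lparr>carrier := ?K\<rparr>) = ?K - {\<zero>\<^bsub>coord_ring n I\<^esub>}"
    proof -
      have u: "residue n I (const c) \<in> Units (coord_ring n I\<lparr>carrier := ?K\<rparr>) \<longleftrightarrow> c \<noteq> 0" for c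
      proof -
        have m: "residue n I (const a) \<otimes>\<^bsub>coord_ring n I\<^esub> residue n I (const b) = \<one>\<^bsub>coord_ring n I\<^esub> \<longleftrightarrow> a * b = 1" for a b
          using eq[of "a * b" 1] by (simp add: cr const_mult)
        have "residue n I (const c) \<in> Units (coord_ring n I\<lparr>carrier := ?K\<rparr>) \<longleftrightarrow> (\<exists>b. b * c = 1 \<and> c * b = 1)"
          by (simp add: Units_def m)
        also have "\<dots> \<longleftrightarrow> c \<noteq> 0" by (metis left_inverse right_inverse mult_zero_right zero_neq_one)
        finally show ?thesis .
      qed
      have sub: "Units (coord_ring n I\<lparr>carrier := ?K\<rparr>) \<subseteq> ?K" by (auto simp: Units_def)
      have z: "residue n I (const c) = \<zero>\<^bsub>coord_ring n I\<^esub> \<longleftrightarrow> c = 0" for c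
        using eq[of c 0] by (simp add: cr)
      show ?thesis
      proof (intro equalityI subsetI)
        fix x assume x: "x \<in> Units (coord_ring n I\<lparr>carrier := ?K\<rparr>)"
        then obtain c where "x = residue n I (const c)" using sub by blast
        then show "x \<in> ?K - {\<zero>\<^bsub>coord_ring n I\<^esub>}" using x u[of c] z[of c] by simp
      next
        fix x assume x: "x \<in> ?K - {\<zero>\<^bsub>coord_ring n I\<^esub>}"
        then obtain c where c: "x = residue n I (const c)" by (elim DiffE rangeE)
        then have "c \<noteq> 0" using x z[of c] by simp
        then show "x \<in> Units (coord_ring n I\<lparr>carrier := ?K\<rparr>)" using u[of c] c by simp
      qed
    qed
  qed
qed

text \<open>The dimension is built up by line extensions, one for each index; a residue already in
  the smaller span would be a relation modulo I.\<close>

lemma dimension_family: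
  assumes "finite K" "\<And>\<kappa>. \<kappa> \<in> K \<Longrightarrow> b \<kappa> \<in> polys n"
    and "\<And>c. (\<Sum>\<kappa>\<in>K. const (c \<kappa>) * b \<kappa>) \<in> I \<Longrightarrow> \<forall>\<kappa>\<in>K. c \<kappa> = 0"
  shows "A.dimension (card K) (range (\<lambda>c. residue n I (const c)))
    (range (\<lambda>c. residue n I (\<Sum>\<kappa>\<in>K. const (c \<kappa>) * b \<kappa>)))"
  using assms
proof (induction K rule: finite_induct)
  case empty
  have "range (\<lambda>c::'a \<Rightarrow> 'k. residue n I (\<Sum>\<kappa>\<in>{}. const (c \<kappa>) * b \<kappa>)) = {\<zero>\<^bsub>coord_ring n I\<^esub>}"
    by (auto simp: coord_ring_simps[OF I])
  then show ?case using A.zero_dim by simp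
next
  case (insert k K)
  let ?C = "range (\<lambda>c. residue n I (const c))"
  let ?E = "\<lambda>K. range (\<lambda>c. residue n I (\<Sum>\<kappa>\<in>K. const (c \<kappa>) * b \<kappa>))"
  note cr = coord_ring_simps[OF I]
  have upd: "(\<Sum>\<kappa>\<in>insert k K. const ((c(k := a)) \<kappa>) * b \<kappa>) = const a * b k + (\<Sum>\<kappa>\<in>K. const (c \<kappa>) * b \<kappa>)"
    for c :: "'a \<Rightarrow> 'k" and a
  proof -
    have "(\<Sum>\<kappa>\<in>K. const ((c(k := a)) \<kappa>) * b \<kappa>) = (\<Sum>\<kappa>\<in>K. const (c \<kappa>) * b \<kappa>)"
      using insert.hyps by (intro sum.cong) auto
    then show ?thesis using insert.hyps by simp
  qed
  have sp: "(\<Sum>\<kappa>\<in>K. const (c \<kappa>) * b \<kappa>) \<in> polys n" for c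
    using insert.prems(1) by (intro polys_sum polys_mult polys_const) auto
  have bk: "b k \<in> polys n" using insert.prems(1) by simp
  have "\<forall>\<kappa>\<in>K. c \<kappa> = 0" if "(\<Sum>\<kappa>\<in>K. const (c \<kappa>) * b \<kappa>) \<in> I" for c
  proof -
    have "\<forall>\<kappa>\<in>insert k K. (c(k := 0)) \<kappa> = 0"
      by (rule insert.prems(2)) (use that in \<open>simp only: upd, simp\<close>)
    then show ?thesis using insert.hyps by (metis fun_upd_apply insertCI)
  qed
  then have dim: "A.dimension (card K) ?C (?E K)"
    using insert.IH insert.prems(1) by blast
  have "residue n I (b k) \<notin> ?E K"
  proof
    assume "residue n I (b k) \<in> ?E K"
    then obtain c where "residue n I (b k) = residue n I (\<Sum>\<kappa>\<in>K. const (c \<kappa>) * b \<kappa>)" by blast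
    then have "b k - (\<Sum>\<kappa>\<in>K. const (c \<kappa>) * b \<kappa>) \<in> I"
      using residue_eq_iff[OF I bk sp] by simp
    then have "- (b k - (\<Sum>\<kappa>\<in>K. const (c \<kappa>) * b \<kappa>)) \<in> I" by (rule ideal_uminus[OF I])
    then have "(\<Sum>\<kappa>\<in>insert k K. const ((c(k := - 1)) \<kappa>) * b \<kappa>) \<in> I"
      unfolding upd using const_minus[of 0 "1::'k"] by simp
    then have "(c(k := - 1)) k = 0" using insert.prems(2) by blast
    then show False by simp
  qed
  moreover have "residue n I (b k) \<in> carrier (coord_ring n I)" using bk by (simp add: cr)
  ultimately have "A.dimension (Suc (card K)) ?C (A.line_extension ?C (residue n I (b k)) (?E K))"
    using dim by (intro A.Suc_dim)
  moreover have "A.line_extension ?C (residue n I (b k)) (?E K) = ?E (insert k K)"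
  proof (intro Set.set_eqI iffI)
    fix x assume "x \<in> A.line_extension ?C (residue n I (b k)) (?E K)"
    then obtain a c where "x = residue n I (const a) \<otimes>\<^bsub>coord_ring n I\<^esub> residue n I (b k)
        \<oplus>\<^bsub>coord_ring n I\<^esub> residue n I (\<Sum>\<kappa>\<in>K. const (c \<kappa>) * b \<kappa>)"
      unfolding A.line_extension_mem_iff by blast
    also have "\<dots> = residue n I (\<Sum>\<kappa>\<in>insert k K. const ((c(k := a)) \<kappa>) * b \<kappa>)"
      unfolding upd using bk sp by (simp add: cr polys_mult)
    finally show "x \<in> ?E (insert k K)" by blast
  next
    fix x assume "x \<in> ?E (insert k K)"
    then obtain c where "x = residue n I (\<Sum>\<kappa>\<in>insert k K. const (c \<kappa>) * b \<kappa>)" by blast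
    also have "\<dots> = residue n I (const (c k)) \<otimes>\<^bsub>coord_ring n I\<^esub> residue n I (b k)
        \<oplus>\<^bsub>coord_ring n I\<^esub> residue n I (\<Sum>\<kappa>\<in>K. const (c \<kappa>) * b \<kappa>)"
      using insert.hyps bk sp by (simp add: cr polys_mult)
    finally show "x \<in> A.line_extension ?C (residue n I (b k)) (?E K)"
      unfolding A.line_extension_mem_iff by blast
  qed
  ultimately show ?case using insert.hyps by simp
qed

lemma hilbert_fun_free_gens:
  assumes Ys: "\<And>i. i \<le> m \<Longrightarrow> Ys ! i \<in> deg_part (polys n) 1"
    and fg: "free_gens n (polys n) I m Ys qs e"
  shows "hilbert_fun n I l = hilb_sum m l qs"
proof -
  let ?C = "range (\<lambda>c. residue n I (const c))"
  have e: "\<And>i. i < length qs \<Longrightarrow> e i \<in> deg_part (polys n) (qs ! i)"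
    using fg by (auto simp: free_gens_def)
  have eh: "\<And>i. i < length qs \<Longrightarrow> homog (qs ! i) (e i)" using e by (simp add: deg_part_def)
  have b: "bf Ys e \<kappa> \<in> deg_part (polys n) l" if "\<kappa> \<in> Ks m l qs" for \<kappa>
    by (rule bf_in_deg_part[OF Ys ideal_polys_ideal e that])
  have cp: "comb Ys qs e v \<in> polys n" if "v \<in> grade (shifted_sum m qs) l" for v
    by (rule comb_in_ideal[OF Ys ideal_polys_ideal])
      (use that e in \<open>auto simp: deg_part_def grade_shifted_sum\<close>)
  have "\<forall>\<kappa>\<in>Ks m l qs. c \<kappa> = 0"
    if c: "(\<Sum>\<kappa>\<in>Ks m l qs. const (c \<kappa>) * bf Ys e \<kappa>) \<in> I" for c
  proof -
    obtain v where v: "v \<in> grade (shifted_sum m qs) l"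
        "\<forall>\<kappa>\<in>Ks m l qs. lookup (v (fst \<kappa>)) (snd \<kappa>) = c \<kappa>"
      using grade_of_coeffs by blast
    have "comb Ys qs e v \<in> I" using c v(2) by (simp add: comb_grade[OF v(1)])
    then have "v = (\<lambda>i. 0)" using fg v(1) by (auto simp: free_gens_def grade_shifted_sum)
    then show ?thesis using v(2) by auto
  qed
  then have "A.dimension (card (Ks m l qs)) ?C
      (range (\<lambda>c. residue n I (\<Sum>\<kappa>\<in>Ks m l qs. const (c \<kappa>) * bf Ys e \<kappa>)))"
    using b by (intro dimension_family) (auto simp: deg_part_def)
  also have "range (\<lambda>c. residue n I (\<Sum>\<kappa>\<in>Ks m l qs. const (c \<kappa>) * bf Ys e \<kappa>)) = coord_grade n I l"
  proof (intro Set.set_eqI iffI)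
    fix x assume "x \<in> range (\<lambda>c. residue n I (\<Sum>\<kappa>\<in>Ks m l qs. const (c \<kappa>) * bf Ys e \<kappa>))"
    then obtain c where "x = residue n I (\<Sum>\<kappa>\<in>Ks m l qs. const (c \<kappa>) * bf Ys e \<kappa>)" by blast
    moreover have "(\<Sum>\<kappa>\<in>Ks m l qs. const (c \<kappa>) * bf Ys e \<kappa>) \<in> polys n"
      using b by (intro polys_sum polys_mult polys_const) (auto simp: deg_part_def)
    moreover have "homog l (\<Sum>\<kappa>\<in>Ks m l qs. const (c \<kappa>) * bf Ys e \<kappa>)"
      using b by (intro homog_sum homog_const_mult) (auto simp: deg_part_def)
    ultimately show "x \<in> coord_grade n I l" by (auto simp: coord_grade_def)
  next
    fix x assume "x \<in> coord_grade n I l"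
    then obtain f where f: "f \<in> deg_part (polys n) l" "x = residue n I f"
      by (auto simp: coord_grade_def deg_part_def)
    then obtain v where v: "v \<in> grade (shifted_sum m qs) l" "f - comb Ys qs e v \<in> I"
      using fg unfolding free_gens_def by blast
    then have "x = residue n I (comb Ys qs e v)"
      using f residue_eq_iff[OF I _ cp[OF v(1)], of f] by (simp add: deg_part_def)
    then show "x \<in> range (\<lambda>c. residue n I (\<Sum>\<kappa>\<in>Ks m l qs. const (c \<kappa>) * bf Ys e \<kappa>))"
      unfolding comb_grade[OF v(1)]
      by (rule range_eqI[where x = "\<lambda>\<kappa>. lookup (v (fst \<kappa>)) (snd \<kappa>)"])
  qed
  finally show ?thesis
    using A.dimI[OF subfield_constants] by (simp add: hilbert_fun_def card_Ks over_def)
qed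

lemma has_degree_free_gens:
  assumes Ys: "\<And>i. i \<le> m \<Longrightarrow> Ys ! i \<in> deg_part (polys n) 1"
    and fg: "free_gens n (polys n) I m Ys qs e" and qs: "qs \<noteq> []"
  shows "has_degree n I m (length qs)"
proof -
  \<comment> \<open>P q is the polynomial x \<mapsto> (x - q + m choose m), written as m monic
    linear factors divided by m!.\<close>
  define P :: "nat \<Rightarrow> rat poly" where
    "P q = Polynomial.smult (1 / fact m) (\<Prod>j<m. [:of_nat m - of_nat q - of_nat j, 1:])" for q
  have lead: "lead_coeff (\<Prod>j<m. [:of_nat m - of_nat q - of_nat j, 1:] :: rat poly) = 1" for q
    by (simp add: lead_coeff_prod)
  have deg: "Polynomial.degree (\<Prod>j<m. [:of_nat m - of_nat q - of_nat j, 1:] :: rat poly) = m" for q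
    by (subst degree_prod_eq_sum_degree) auto
  have P: "Polynomial.degree (P q) = m" "coeff (P q) m = 1 / fact m" for q
    using lead[of q] deg[of q] by (simp_all add: P_def)
  define H where "H = (\<Sum>i<length qs. P (qs ! i))"
  have cH: "coeff H m = of_nat (length qs) / fact m"
    by (simp add: H_def coeff_sum P)
  moreover have "Polynomial.degree H \<le> m"
    unfolding H_def by (rule degree_sum_le) (simp_all add: P)
  \<comment> \<open>Since qs is nonempty, the coefficient of H at m is nonzero.\<close>
  ultimately have "Polynomial.degree H = m"
    using qs le_degree[of H m] by (intro antisym) auto
  \<comment> \<open>The sum of the shifts is a crude common bound for them; beyond it no subtraction
    \<open>l - qs ! i\<close> is truncated.\<close>
  moreover have "of_nat (hilbert_fun n I l) = poly H (of_nat l)" if l: "l \<ge> sum_list qs" for l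
  proof -
    have "poly (P (qs ! i)) (of_nat l) = of_nat (hilb m l (qs ! i))" if i: "i < length qs" for i
    proof -
      have le: "qs ! i \<le> l" using l member_le_sum_list[of "qs ! i" qs] i by simp
      have "poly (P (qs ! i)) (of_nat l) = (\<Prod>j<m. of_nat (l - qs ! i + m) - of_nat j) / fact m"
        using le by (simp add: P_def poly_prod of_nat_diff algebra_simps)
      also have "\<dots> = of_nat (l - qs ! i + m) gchoose m"
        by (simp add: gbinomial_prod_rev atLeast0LessThan)
      finally show ?thesis using le by (simp add: hilb_def binomial_gbinomial)
    qed
    then show ?thesis
      by (simp add: hilbert_fun_free_gens[OF Ys fg] hilb_sum_def H_def poly_sum)
  qed
  ultimately show ?thesis
    unfolding has_degree_def using cH
    by (intro exI[of _ H]) (auto simp: eventually_sequentially)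
qed

end

text \<open>Two Hilbert polynomials agree at infinitely many integers and are therefore
  equal.\<close>

lemma has_degree_unique:
  assumes "has_degree n I m d" "has_degree n I m d'"
  shows "d = d'"
proof -
  obtain H where H: "Polynomial.lead_coeff H = of_nat d / fact m"
      "\<forall>\<^sub>F l in sequentially. of_nat (hilbert_fun n I l) = poly H (of_nat l :: rat)"
    using assms(1) by (auto simp: has_degree_def)
  obtain H' where H': "Polynomial.lead_coeff H' = of_nat d' / fact m"
      "\<forall>\<^sub>F l in sequentially. of_nat (hilbert_fun n I l) = poly H' (of_nat l :: rat)"
    using assms(2) by (auto simp: has_degree_def)
  have "\<forall>\<^sub>F l in sequentially. poly H (of_nat l) = poly H' (of_nat l)"
    using H(2) H'(2) by eventually_elim simp
  then obtain N where N: "\<And>l. l \<ge> N \<Longrightarrow> poly (H - H') (of_nat l) = 0"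
    by (auto simp: eventually_sequentially)
  have "H - H' = 0"
  proof (rule ccontr)
    assume "H - H' \<noteq> 0"
    then have "finite {x. poly (H - H') x = 0}" by (rule poly_roots_finite)
    moreover have "of_nat ` {N..} \<subseteq> {x. poly (H - H') x = 0}" using N by auto
    ultimately have "finite (of_nat ` {N..} :: rat set)" using finite_subset by blast
    then have "finite {N..}" using finite_imageD[of "of_nat :: nat \<Rightarrow> rat"] by (auto simp: inj_on_def)
    then show False using infinite_Ici by blast
  qed
  then show ?thesis using H(1) H'(1) by simp
qed

subsection \<open>Counting\<close>

lemma hilb_sum_sum_list: "hilb_sum m l qs = sum_list (map (hilb m l) qs)"
  by (simp add: hilb_sum_def sum_list_sum_nth atLeast0LessThan)

text \<open>Numerical form of the exact sequence 0 \<rightarrow> R_m[-1] \<rightarrow> R_m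
  \<rightarrow> R_(m-1) \<rightarrow> 0, shifted by q.\<close>

lemma hilb_Suc:
  assumes "m \<ge> 1"
  shows "hilb m l q = hilb (m - 1) l q + hilb m l (Suc q)"
proof -
  obtain m' where m: "m = Suc m'" using assms by (cases m) auto
  show ?thesis
  proof (cases "q < l")
    case True
    then obtain k where "l = Suc (q + k)" using less_imp_Suc_add by blast
    then show ?thesis by (simp add: hilb_def m)
  next
    case False
    then show ?thesis by (auto simp: hilb_def)
  qed
qed

text \<open>Adding up \<open>hilb_Suc\<close> for the shifts from a to b - 1; this is where an
  interval of the claimed sequence comes from.\<close>

lemma hilb_telescope:
  assumes "m \<ge> 1" "a \<le> b"
  shows "sum_list (map (hilb (m - 1) l) [a..<b]) + hilb m l b = hilb m l a"
  using assms(2)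
proof (induction rule: dec_induct)
  case (step k)
  then show ?case using hilb_Suc[OF assms(1), of l k] by simp
qed simp

lemma hilb_sum_sort_concat:
  assumes "m \<ge> 1" "length ms = length ns" "\<And>i. i < length ms \<Longrightarrow> ms ! i \<le> ns ! i"
  shows "hilb_sum (m - 1) l (sort (concat (map (\<lambda>i. [ms ! i..<ns ! i]) [0..<length ms]))) + hilb_sum m l ns
    = hilb_sum m l ms"
proof -
  let ?C = "concat (map (\<lambda>i. [ms ! i..<ns ! i]) [0..<length ms])"
  have "sum_list (map (hilb (m - 1) l) (sort ?C)) = sum_list (map (hilb (m - 1) l) ?C)"
    by (simp flip: sum_mset_sum_list)
  also have "\<dots> = (\<Sum>i\<leftarrow>[0..<length ms]. sum_list (map (hilb (m - 1) l) [ms ! i..<ns ! i]))"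
  proof -
    have "sum_list (map f (concat xss)) = (\<Sum>xs\<leftarrow>xss. sum_list (map f xs))"
      for f :: "nat \<Rightarrow> nat" and xss
      by (induction xss) auto
    then show ?thesis by (simp add: o_def)
  qed
  also have "\<dots> = (\<Sum>i<length ms. sum_list (map (hilb (m - 1) l) [ms ! i..<ns ! i]))"
    by (simp add: interv_sum_list_conv_sum_set_nat atLeast0LessThan)
  finally have *: "hilb_sum (m - 1) l (sort ?C) = (\<Sum>i<length ms. sum_list (map (hilb (m - 1) l) [ms ! i..<ns ! i]))"
    by (simp add: hilb_sum_sum_list)
  show ?thesis
    unfolding * using assms hilb_telescope[OF assms(1)]
    by (simp add: hilb_sum_def flip: sum.distrib)
qed

lemma hilb_sum_count:
  "hilb_sum m l qs = (\<Sum>j\<le>l. count_list qs j * hilb m l j)"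
proof -
  have "hilb_sum m l qs = (\<Sum>j\<in>set qs \<union> {..l}. count_list qs j * hilb m l j)"
    unfolding hilb_sum_sum_list by (rule sum_list_map_eq_sum_count2) auto
  also have "\<dots> = (\<Sum>j\<le>l. count_list qs j * hilb m l j)"
    by (rule sum.mono_neutral_right) (auto simp: hilb_def)
  finally show ?thesis .
qed

text \<open>The multiplicities solve a unitriangular system: in degree l the entry l contributes 1
  and larger entries contribute nothing, so counts are recovered by induction on l.\<close>

lemma hilb_sum_inj:
  assumes "sorted ps" "sorted qs" "\<And>l. hilb_sum m l ps = hilb_sum m l qs"
  shows "ps = qs"
proof -
  have "count_list ps l = count_list qs l" for l
  proof (induction l rule: less_induct)
    case (less l)
    have "{..l} = insert l {..<l}" by auto
    then have "hilb_sum m l rs = count_list rs l + (\<Sum>j<l. count_list rs j * hilb m l j)" for rs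
      by (simp add: hilb_sum_count hilb_def)
    then show ?case using less assms(3)[of l] by simp
  qed
  then have "mset ps = mset qs" by (intro multiset_eqI) (simp add: count_mset)
  then show ?thesis using assms(1,2) by (metis properties_for_sort sorted_sort_id)
qed

subsection \<open>Points where a polynomial does not vanish\<close>

text \<open>Residues modulo B give the lowest digits, induction the others. It makes the exponents
  in the Kronecker substitution distinct for distinct monomials.\<close>

lemma base_expansion_inj:
  fixes a b :: "nat \<Rightarrow> nat"
  assumes "\<And>i. i < N \<Longrightarrow> a i < B" "\<And>i. i < N \<Longrightarrow> b i < B"
    and "(\<Sum>i<N. a i * B ^ i) = (\<Sum>i<N. b i * B ^ i)" and "i < N"
  shows "a i = b i"
  using assms
proof (induction N arbitrary: a b i)
  case (Suc N)
  have split: "(\<Sum>i<Suc N. c i * B ^ i) = c 0 + B * (\<Sum>i<N. c (Suc i) * B ^ i)" for c :: "nat \<Rightarrow> nat"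
    by (simp add: sum.lessThan_Suc_shift sum_distrib_left mult_ac del: sum.lessThan_Suc)
  have lt: "a 0 < B" "b 0 < B" using Suc.prems(1,2) by auto
  have eq: "a 0 + B * (\<Sum>i<N. a (Suc i) * B ^ i) = b 0 + B * (\<Sum>i<N. b (Suc i) * B ^ i)"
    using Suc.prems(3) unfolding split .
  have 0: "a 0 = b 0"
    using arg_cong[OF eq, of "\<lambda>x. x mod B"] lt by simp
  then have "(\<Sum>i<N. a (Suc i) * B ^ i) = (\<Sum>i<N. b (Suc i) * B ^ i)"
    using eq lt by simp
  then have "a (Suc j) = b (Suc j)" if "j < N" for j
    using Suc.IH[of "\<lambda>i. a (Suc i)" "\<lambda>i. b (Suc i)" j] Suc.prems(1,2) that by simp
  then show ?case using 0 Suc.prems(4) by (cases i) auto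
qed simp

text \<open>
  Kronecker substitution: \<open>x\<^sub>i = y\<^bsup>B^i\<^esup>\<close> with \<open>B\<close> above all exponents keeps the monomials of
  \<open>p\<close> apart.
\<close>

lemma nonvanishing_point:
  fixes p :: "'k::field_char_0 mpoly"
  assumes "p \<noteq> 0"
  shows "\<exists>x. (\<forall>i. x i \<noteq> 0) \<and> pt.ev x p \<noteq> 0"
proof -
  \<comment> \<open>N bounds the variables and B the exponents, both strictly;
    \<open>insert 0\<close> keeps the maximum defined when p is constant.\<close>
  define N where "N = Suc (Max (insert 0 (\<Union>t\<in>keys p. keys t)))"
  define B where "B = Suc (\<Sum>t\<in>keys p. mono_deg t)"
  define w where "w t = (\<Sum>i<N. lookup t i * B ^ i)" for t :: "nat \<Rightarrow>\<^sub>0 nat"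
  have N: "keys t \<subseteq> {..<N}" if "t \<in> keys p" for t
    using that by (auto simp: N_def less_Suc_eq_le intro!: Max_ge)
  have B: "lookup t i < B" if t: "t \<in> keys p" for t i
  proof -
    have "lookup t i \<le> mono_deg t"
      unfolding mono_deg_def by (cases "i \<in> keys t") (auto intro: member_le_sum simp: in_keys_iff)
    also have "\<dots> \<le> (\<Sum>t\<in>keys p. mono_deg t)" using t by (intro member_le_sum) auto
    finally show ?thesis by (simp add: B_def)
  qed
  have inj: "s = t" if "s \<in> keys p" "t \<in> keys p" "w s = w t" for s t
  proof (rule poly_mapping_eqI)
    fix i
    show "lookup s i = lookup t i"
    proof (cases "i < N")
      case True
      then show ?thesis
        using base_expansion_inj[of N "lookup s" B "lookup t" i] that B by (simp add: w_def)
    next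
      case False
      then have "i \<notin> keys s" "i \<notin> keys t" using N that by auto
      then show ?thesis by (simp add: in_keys_iff)
    qed
  qed
  define Q where "Q = (\<Sum>t\<in>keys p. Polynomial.monom (lookup p t) (w t))"
  have "keys p \<noteq> {}" using assms by simp
  then obtain s where s: "s \<in> keys p" by blast
  \<comment> \<open>Since monomials of p have distinct weights, nothing can cancel the coefficient
    coming from s.\<close>
  have "coeff Q (w s) = (\<Sum>t\<in>keys p. if t = s then lookup p t else 0)"
    unfolding Q_def coeff_sum using inj s by (intro sum.cong) auto
  also have "\<dots> = lookup p s" using s by simp
  finally have "Q \<noteq> 0" using s by (auto simp: in_keys_iff)
  \<comment> \<open>Zero is excluded along with the roots so that all coordinates of the point are
    nonzero and any of them can later be scaled to 1.\<close>
  then have "finite ({y. poly Q y = 0} \<union> {0})" using poly_roots_finite by auto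
  then obtain y where y: "poly Q y \<noteq> 0" "y \<noteq> 0"
    using ex_new_if_finite[OF infinite_UNIV_char_0] by blast
  define x where "x i = y ^ (B ^ i)" for i :: nat
  have "mval x t = y ^ w t" if "t \<in> keys p" for t
    using mval_superset[OF _ N[OF that], of x]
    by (simp add: x_def w_def power_sum mult.commute flip: power_mult)
  then have "pt.ev x p = poly Q y"
    by (simp add: pt.ev_def Q_def poly_sum poly_monom)
  then show ?thesis using y by (intro exI[of _ x]) (auto simp: x_def)
qed

lemma mval_scale: "mval (\<lambda>i. c * x i) t = c ^ mono_deg t * mval x t"
  by (simp add: mval_def mono_deg_def power_mult_distrib prod.distrib power_sum)

lemma homog_ev_scale:
  assumes "homog l p"
  shows "pt.ev (\<lambda>i. c * x i) p = c ^ l * pt.ev x p"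
proof -
  have "pt.ev (\<lambda>i. c * x i) p = (\<Sum>t\<in>keys p. c ^ l * (lookup p t * mval x t))"
    unfolding pt.ev_def mval_scale
    by (rule sum.cong) (use assms in \<open>auto simp: homog_def\<close>)
  then show ?thesis by (simp add: pt.ev_def sum_distrib_left)
qed

lemma nonvanishing_point_normalised:
  fixes p :: "'k::field_char_0 mpoly"
  assumes "p \<noteq> 0" "homog l p"
  shows "\<exists>x. x m = 1 \<and> pt.ev x p \<noteq> 0"
proof -
  obtain x where x: "\<And>i. x i \<noteq> 0" "pt.ev x p \<noteq> 0"
    using nonvanishing_point[OF assms(1)] by blast
  then show ?thesis
    by (intro exI[of _ "\<lambda>i. inverse (x m) * x i"]) (simp add: homog_ev_scale[OF assms(2)])
qed

section \<open>Restriction of polynomials to the line through a point\<close>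

lemma const_mval: "mval (\<lambda>i. const (u i)) t = const (mval u t)"
proof -
  have "const (prod f A) = (\<Prod>a\<in>A. const (f a))" for f :: "nat \<Rightarrow> 'a" and A
    by (induction A rule: infinite_finite_induct) (simp_all add: const_mult)
  moreover have "const (c ^ a) = const c ^ a" for c :: 'a and a
    by (induction a) (simp_all add: const_mult)
  ultimately show ?thesis by (simp add: mval_def)
qed

text \<open>On the line through u a form of degree l is its value at u times the l-th power of the
  parameter. This is how k[Y_0, ..., Y_m] collapses to k[Y_m] modulo the Z_j.\<close>

lemma ev_line:
  assumes "homog l p"
  shows "sb.ev (\<lambda>i. y * const (u i)) p = const (pt.ev u p) * y ^ l"
proof -
  have "sb.ev (\<lambda>i. y * const (u i)) p = (\<Sum>t\<in>keys p. const (lookup p t * mval u t) * y ^ l)"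
    unfolding sb.ev_def mval_scale const_mval
    by (rule sum.cong) (use assms in \<open>auto simp: homog_def const_mult\<close>)
  then show ?thesis by (simp add: pt.ev_def const_sum sum_distrib_right)
qed

text \<open>Factors are exchanged one at a time. It is applied with the forms Y_i for x and u_i Y_m
  for y.\<close>

lemma mval_cong_ideal:
  assumes J: "ideal J (poly_ring n)"
    and xy: "\<And>i. i \<in> keys t \<Longrightarrow> x i \<in> polys n \<and> y i \<in> polys n \<and> x i - y i \<in> J"
  shows "mval x t - mval y t \<in> J"
proof -
  have mult: "a * b - a' * b' \<in> J"
    if "a - a' \<in> J" "b - b' \<in> J" "b \<in> polys n" "a' \<in> polys n" for a a' b b'
  proof -
    have "a * b - a' * b' = (a - a') * b + a' * (b - b')" by (simp add: algebra_simps)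
    then show ?thesis using that by (simp add: ideal_add[OF J] ideal_mult[OF J] ideal_mult'[OF J])
  qed
  have pow: "x i ^ a - y i ^ a \<in> J" if "i \<in> keys t" for i a
    by (induction a) (use xy[OF that] in \<open>auto intro!: mult polys_power simp: ideal_0[OF J]\<close>)
  have "(\<Prod>i\<in>A. x i ^ lookup t i) - (\<Prod>i\<in>A. y i ^ lookup t i) \<in> J" if "finite A" "A \<subseteq> keys t" for A
    using that
  proof (induction A rule: finite_induct)
    case empty
    then show ?case by (simp add: ideal_0[OF J])
  next
    case (insert i A)
    then show ?case
      using xy by (auto intro!: mult pow polys_prod polys_power)
  qed
  then show ?thesis by (simp add: mval_def)
qed

section \<open>Growth of Hilbert functions with equal ranks\<close>

lemma binomial_le_shift:
  assumes "m \<ge> 1"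
  shows "(N + c choose m) \<le> (N choose m) + c * (N + c choose (m - 1))"
proof (induction c)
  case (Suc c)
  obtain m' where m: "m = Suc m'" using assms by (cases m) auto
  have "(N + Suc c choose m) = (N + c choose m) + (N + c choose (m - 1))" by (simp add: m)
  also have "\<dots> \<le> (N choose m) + c * (N + c choose (m - 1)) + (N + c choose (m - 1))"
    using Suc.IH by simp
  \<comment> \<open>By monotonicity all increments in Pascal's rule are bounded by a common, larger
    binomial coefficient.\<close>
  also have "\<dots> \<le> (N choose m) + Suc c * (N + Suc c choose (m - 1))"
    using mult_le_mono2[OF binomial_right_mono[of "N + c" "N + Suc c" "m - 1"], of "Suc c"]
    unfolding mult_Suc by linarith
  finally show ?case .
qed simp

text \<open>With equally many shifts the leading terms cancel, so the difference of the two sums is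
  at most of order l^(m-1), whereas dim R_m(l) has order l^m.\<close>

lemma hilb_sum_deficit:
  assumes "m \<ge> 1" "length ms = length ns"
  shows "\<exists>l. hilb_sum m l ms < hilb_sum m l ns + (l + m choose m)"
proof (rule ccontr)
  assume "\<not> ?thesis"
  then have le: "hilb_sum m l ns + (l + m choose m) \<le> hilb_sum m l ms" for l
    by (meson not_le)
  define c where "c = sum_list ns"
  define d where "d = length ms"
  \<comment> \<open>c bounds every n_i, so \<open>l - ns ! i\<close> is at least k. The size of k
    contradicts the final inequality l + 1 \<le> d c m.\<close>
  define k where "k = d * c * m"
  define l where "l = c + k"
  have "hilb m l q \<le> (l + m choose m)" for q
    by (auto simp: hilb_def intro!: binomial_right_mono)
  then have "hilb_sum m l ms \<le> d * (l + m choose m)"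
    unfolding hilb_sum_def d_def using sum_bounded_above[of "{..<length ms}" "\<lambda>i. hilb m l (ms ! i)" "l + m choose m"] by simp
  moreover have "hilb m l (ns ! i) \<ge> (k + m choose m)" if "i < length ns" for i
  proof -
    have "ns ! i \<le> c" using that member_le_sum_list[of "ns ! i" ns] by (simp add: c_def)
    then show ?thesis by (auto simp: hilb_def l_def intro!: binomial_right_mono)
  qed
  then have "hilb_sum m l ns \<ge> d * (k + m choose m)"
    unfolding hilb_sum_def d_def assms(2) using sum_bounded_below[of "{..<length ns}" "k + m choose m" "\<lambda>i. hilb m l (ns ! i)"] by simp
  ultimately have "d * (k + m choose m) + (l + m choose m) \<le> d * (l + m choose m)"
    using le[of l] by simp
  also have "\<dots> \<le> d * ((k + m choose m) + c * (l + m choose (m - 1)))"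
    using binomial_le_shift[OF assms(1), of "k + m" c] by (intro mult_le_mono2) (simp add: l_def add_ac)
  finally have 1: "(l + m choose m) \<le> d * c * (l + m choose (m - 1))"
    by (simp add: algebra_simps)
  obtain m' where m: "m = Suc m'" using assms by (cases m) auto
  \<comment> \<open>The absorption identity compares the two binomial coefficients exactly, so the
    common factor can be cancelled.\<close>
  have "(l + m choose m) * m = (l + m choose (m - 1)) * (l + 1)"
    using Suc_times_binomial_add[of m' l] by (simp add: m mult.commute add_ac)
  then have "(l + m choose (m - 1)) * (l + 1) \<le> (l + m choose (m - 1)) * (d * c * m)"
    using mult_le_mono1[OF 1, of m] by (simp add: mult_ac)
  moreover have "(l + m choose (m - 1)) > 0" by simp
  ultimately have "l + 1 \<le> d * c * m" by (simp only: mult_le_cancel1)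
  then show False by (simp add: l_def k_def)
qed

subsection \<open>Generators of the coordinate ring of a hypersurface\<close>

text \<open>If n_i < m_i, then at least i + 1 entries of ns are at most n_i, but at most i entries
  of ms are.\<close>

lemma nth_le_if_card_le:
  fixes ms ns :: "nat list"
  assumes "sorted ms" "sorted ns" "length ns = length ms"
    and card: "\<And>l. card {k. k < length ns \<and> ns ! k \<le> l} \<le> card {i. i < length ms \<and> ms ! i \<le> l}"
    and i: "i < length ms"
  shows "ms ! i \<le> ns ! i"
proof (rule ccontr)
  assume "\<not> ms ! i \<le> ns ! i"
  then have lt: "ns ! i < ms ! i" by simp
  have "{..i} \<subseteq> {k. k < length ns \<and> ns ! k \<le> ns ! i}"
    using assms i by (auto intro: sorted_nth_mono)
  then have "Suc i \<le> card {k. k < length ns \<and> ns ! k \<le> ns ! i}"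
    using card_mono[of "{k. k < length ns \<and> ns ! k \<le> ns ! i}" "{..i}"] by simp
  also have "\<dots> \<le> card {j. j < length ms \<and> ms ! j \<le> ns ! i}" by (rule card)
  also have "\<dots> \<le> card {..<i}"
  proof (rule card_mono)
    show "{j. j < length ms \<and> ms ! j \<le> ns ! i} \<subseteq> {..<i}"
    proof clarsimp
      fix j assume j: "j < length ms" "ms ! j \<le> ns ! i"
      show "j < i"
      proof (rule ccontr)
        assume "\<not> j < i"
        then have "ms ! i \<le> ms ! j" using assms(1) j by (intro sorted_nth_mono) auto
        then show False using lt j by simp
      qed
    qed
  qed simp
  finally show False by simp
qed

text \<open>Here e lifts a basis of A_X and g a basis of I_Y/I_X, both over R_m acting through Ys;
  the equality of the lengths expresses equality of ranks.\<close>

locale hypersurface =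
  fixes n m :: nat and IX IY :: "'k::field_char_0 mpoly set" and Ys :: "'k mpoly list"
    and ms ns :: "nat list" and e g :: "nat \<Rightarrow> 'k mpoly"
  assumes IX: "ideal IX (poly_ring n)" and hIY: "homog_ideal n IY" and IXY: "IX \<subseteq> IY"
    and proper: "1 \<notin> IY" and m: "m \<ge> 1"
    and Ys: "\<And>i. i \<le> m \<Longrightarrow> Ys ! i \<in> deg_part (polys n) 1"
    and len: "length ns = length ms"
    and sorted_ms: "sorted ms" and sorted_ns: "sorted ns"
    and e: "free_gens n (polys n) IX m Ys ms e"
    and g: "free_gens n IY IX m Ys ns g"
begin

lemma IY: "ideal IY (poly_ring n)"
  using hIY by (simp add: homog_ideal_def)

lemma e_deg: "i < length ms \<Longrightarrow> e i \<in> deg_part (polys n) (ms ! i)"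
  using e by (simp add: free_gens_def)

lemma e_gen: "f \<in> deg_part (polys n) l \<Longrightarrow> \<exists>v\<in>grade (shifted_sum m ms) l. f - comb Ys ms e v \<in> IX"
  using e unfolding free_gens_def by blast

lemma g_deg: "i < length ns \<Longrightarrow> g i \<in> deg_part IY (ns ! i)"
  using g by (simp add: free_gens_def)

lemma g_gen: "f \<in> deg_part IY l \<Longrightarrow> \<exists>v\<in>grade (shifted_sum m ns) l. f - comb Ys ns g v \<in> IX"
  using g unfolding free_gens_def by blast

lemma g_free: "v \<in> carrier (shifted_sum m ns) \<Longrightarrow> comb Ys ns g v \<in> IX \<Longrightarrow> v = (\<lambda>i. 0)"
  using g unfolding free_gens_def by blast

lemma dim_IY: "mp.dim (deg_part IY l) = mp.dim (deg_part IX l) + hilb_sum m l ns"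
  by (rule free_gens_dim[OF Ys IX IY IXY g])

lemma dim_polys: "mp.dim (deg_part (polys n :: 'k mpoly set) l) = mp.dim (deg_part IX l) + hilb_sum m l ms"
  by (rule free_gens_dim[OF Ys IX ideal_polys_ideal _ e]) (use ideal_polys[OF IX] in auto)

text \<open>\<open>X\<close> and \<open>I\<^bsub>Y/X\<^esub>\<close> have the same rank, so the coordinate ring of \<open>Y\<close> grows too slowly to contain \<open>R\<^sub>m\<close>.\<close>

lemma annihilator:
  "\<exists>l \<delta>. \<delta> \<noteq> 0 \<and> \<delta> \<in> polys m \<and> homog l \<delta> \<and> subst Ys \<delta> \<in> IY"
proof (rule ccontr)
  assume no: "\<not> ?thesis"
  \<comment> \<open>Without an annihilator the degree-l monomials in Ys are independent modulo I_Y
    and fit into the degree-l part of A_Y.\<close>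
  have "hilb_sum m l ns + (l + m choose m) \<le> hilb_sum m l ms" for l
  proof -
    let ?F = "(\<lambda>t. mterm t (1::'k)) ` monomials n l"
    have mon: "mterm t c \<in> polys m \<and> homog l (mterm t c)" if "t \<in> monomials m l" for t and c :: 'k
      using that by (auto simp: monomials_def polys_single)
    have "mval ((!) Ys) t \<in> deg_part (polys n) l" if "t \<in> monomials m l" for t
      using mon[OF that, of 1] subst_polys[OF Ys, where r = "mterm t 1"]
        subst_homog[OF Ys, where r = "mterm t 1" and l = l] by (auto simp: deg_part_def)
    moreover have "\<forall>t\<in>monomials m l. c t = 0"
      if c: "(\<Sum>t\<in>monomials m l. const (c t) * mval ((!) Ys) t) \<in> deg_part IY l" for c
    proof
      fix t assume t: "t \<in> monomials m l"
      define \<delta> where "\<delta> = (\<Sum>t\<in>monomials m l. mterm t (c t))"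
      have "\<delta> \<in> polys m" "homog l \<delta>"
        unfolding \<delta>_def using mon by (auto intro!: polys_sum homog_sum)
      moreover have "subst Ys \<delta> \<in> IY"
        using c by (simp add: \<delta>_def subst_sum deg_part_def)
      ultimately have "\<delta> = 0" using no by blast
      moreover have "lookup \<delta> t = c t"
        using t by (simp add: \<delta>_def lookup_sum lookup_single when_def)
      ultimately show "c t = 0" by simp
    qed
    ultimately have "mp.dim (deg_part IY l) + card (monomials m l) \<le> mp.dim (deg_part (polys n :: 'k mpoly set) l)"
      using ideal_polys[OF IY]
      by (intro mp.dim_ge_family[OF _ deg_part_polys_span subspace_deg_part[OF IY] deg_part_mono]) auto
    then show ?thesis using card_monomials[of m l] by (simp add: dim_IY dim_polys)
  qed
  then show False using hilb_sum_deficit[OF m, of ms ns] len by (metis not_le)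
qed

end

text \<open>Row \<open>a k\<close> writes g_k in the basis e. Row \<open>s i\<close> writes \<delta>
  e_i, which lies in I_Y, in the basis g; it takes the place of an adjugate matrix. The gradings
  make the entries homogeneous of degrees n_k - m_i and l_0 + m_i - n_k, and zero where these are
  negative.\<close>

locale hypersurface_section = hypersurface n m IX IY Ys ms ns e g
  for n m and IX IY :: "'k::field_char_0 mpoly set" and Ys ms ns e g +
  fixes \<delta> :: "'k mpoly" and l\<^sub>0 :: nat and u :: "nat \<Rightarrow> 'k"
    and a s :: "nat \<Rightarrow> nat \<Rightarrow> 'k mpoly"
  assumes \<delta>: "\<delta> \<in> polys m" "homog l\<^sub>0 \<delta>" "subst Ys \<delta> \<in> IY"
    and u: "u m = 1" "pt.ev u \<delta> \<noteq> 0"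
    and a: "\<And>k. k < length ns \<Longrightarrow> a k \<in> grade (shifted_sum m ms) (ns ! k)"
      "\<And>k. k < length ns \<Longrightarrow> g k - comb Ys ms e (a k) \<in> IX"
    and s: "\<And>i. i < length ms \<Longrightarrow> s i \<in> grade (shifted_sum m ns) (l\<^sub>0 + ms ! i)"
      "\<And>i. i < length ms \<Longrightarrow> subst Ys \<delta> * e i - comb Ys ns g (s i) \<in> IX"
begin

section \<open>The quotient of the coordinate ring of Y by the forms vanishing at u\<close>

abbreviation "Y \<equiv> Ys ! m"

definition Zs :: "'k mpoly list" where
  "Zs = map (\<lambda>j. Ys ! j - Y * const (u j)) [0..<m]"

lemma Zs_nth: "j < m \<Longrightarrow> Zs ! j = Ys ! j - Y * const (u j)"
  by (simp add: Zs_def)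

lemma Y_polys: "Y \<in> polys n" and Y_homog: "homog 1 Y"
  using Ys[of m] by (auto simp: deg_part_def)

lemma Zs_deg: "j < m \<Longrightarrow> Zs ! j \<in> deg_part (polys n) 1"
  using Ys[of j] polys_mult[OF Y_polys polys_const, of "u j"] homog_mult[OF Y_homog, of 0 "const (u j)"]
  by (auto simp: Zs_nth deg_part_def intro: polys_diff homog_diff)

text \<open>The ideal I_Y + (Z), written out so that the coefficients of the Z_j can be read off in
  the Nakayama argument.\<close>

definition J :: "'k mpoly set" where
  "J = {y + (\<Sum>j<m. Zs ! j * f j) | y f. y \<in> IY \<and> (\<forall>j<m. f j \<in> polys n)}"

lemma J_I: "y \<in> IY \<Longrightarrow> (\<And>j. j < m \<Longrightarrow> f j \<in> polys n) \<Longrightarrow> y + (\<Sum>j<m. Zs ! j * f j) \<in> J"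
  by (auto simp: J_def)

lemma J_E:
  assumes "x \<in> J"
  obtains y f where "y \<in> IY" "\<And>j. j < m \<Longrightarrow> f j \<in> polys n" "x = y + (\<Sum>j<m. Zs ! j * f j)"
  using assms by (auto simp: J_def)

lemma IY_J: "y \<in> IY \<Longrightarrow> y \<in> J"
  using J_I[of y "\<lambda>j. 0"] by simp

lemma Zs_J: "j < m \<Longrightarrow> Zs ! j \<in> J"
  using J_I[OF ideal_0[OF IY], of "\<lambda>i. if i = j then 1 else 0"]
  by (simp add: if_distrib[of "(*) _"] sum.delta cong: if_cong)

lemma ideal_J: "ideal J (poly_ring n)"
proof (rule poly_ring_idealI)
  show "J \<subseteq> polys n"
    using ideal_polys[OF IY] Zs_deg
    by (auto simp: J_def deg_part_def intro!: polys_add polys_sum polys_mult)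
  show "0 \<in> J" by (rule IY_J[OF ideal_0[OF IY]])
  fix x assume x: "x \<in> J"
  then obtain y f where f: "y \<in> IY" "\<And>j. j < m \<Longrightarrow> f j \<in> polys n" "x = y + (\<Sum>j<m. Zs ! j * f j)"
    by (rule J_E) blast
  {
    fix x' assume "x' \<in> J"
    then obtain y' f' where f': "y' \<in> IY" "\<And>j. j < m \<Longrightarrow> f' j \<in> polys n" "x' = y' + (\<Sum>j<m. Zs ! j * f' j)"
      by (rule J_E) blast
    have eq: "x + x' = (y + y') + (\<Sum>j<m. Zs ! j * (f j + f' j))"
      by (simp add: f f' distrib_left sum.distrib)
    show "x + x' \<in> J"
      unfolding eq by (rule J_I) (use f f' in \<open>auto intro: ideal_add[OF IY] polys_add\<close>)
  }
  fix r :: "'k mpoly" assume r: "r \<in> polys n"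
  have eq: "r * x = r * y + (\<Sum>j<m. Zs ! j * (r * f j))"
    by (simp add: f distrib_left sum_distrib_left mult_ac)
  show "r * x \<in> J"
    unfolding eq by (rule J_I) (use f r in \<open>auto intro: ideal_mult[OF IY] polys_mult\<close>)
qed

lemma Ys_J: "i \<le> m \<Longrightarrow> Ys ! i - Y * const (u i) \<in> J"
  using Zs_J[of i] u(1) ideal_0[OF ideal_J] by (cases "i = m") (auto simp: Zs_nth)

text \<open>Modulo J each Y_i is u_i Y_m, including i = m because u_m = 1; so a form r of degree l
  becomes r(u) Y_m^l.\<close>

lemma subst_J:
  assumes r: "r \<in> polys m" "homog l r"
  shows "subst Ys r - const (pt.ev u r) * Y ^ l \<in> J"
proof -
  have "mval ((!) Ys) t - mval (\<lambda>i. Y * const (u i)) t \<in> J" if "t \<in> keys r" for t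
  proof (rule mval_cong_ideal[OF ideal_J])
    fix i assume "i \<in> keys t"
    then have "i \<le> m" using r(1) that by (auto simp: polys_def)
    then show "Ys ! i \<in> polys n \<and> Y * const (u i) \<in> polys n \<and> Ys ! i - Y * const (u i) \<in> J"
      using Ys[of i] Ys_J Y_polys by (auto simp: deg_part_def intro: polys_mult)
  qed
  then have "(\<Sum>t\<in>keys r. const (lookup r t) * (mval ((!) Ys) t - mval (\<lambda>i. Y * const (u i)) t)) \<in> J"
    by (intro ideal_sum[OF ideal_J] ideal_mult[OF ideal_J]) auto
  also have "(\<Sum>t\<in>keys r. const (lookup r t) * (mval ((!) Ys) t - mval (\<lambda>i. Y * const (u i)) t)) =
      subst Ys r - sb.ev (\<lambda>i. Y * const (u i)) r"
    by (simp add: subst_eq_ev sb.ev_def right_diff_distrib sum_subtractf)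
  finally show ?thesis by (simp add: ev_line[OF r(2)])
qed

text \<open>\<delta> lies in I_Y, yet modulo J it is the invertible scalar \<delta>(u) times this
  power. Hence a point of Y on which all Z_j vanish is also a zero of Y_m.\<close>

lemma Y_power_J: "Y ^ l\<^sub>0 \<in> J"
proof -
  have "const (pt.ev u \<delta>) * Y ^ l\<^sub>0 \<in> J"
    using ideal_diff[OF ideal_J IY_J[OF \<delta>(3)] subst_J[OF \<delta>(1,2)]] by simp
  then have "const (inverse (pt.ev u \<delta>)) * (const (pt.ev u \<delta>) * Y ^ l\<^sub>0) \<in> J"
    by (rule ideal_mult[OF ideal_J _ polys_const])
  also have "const (inverse (pt.ev u \<delta>)) * (const (pt.ev u \<delta>) * Y ^ l\<^sub>0) = Y ^ l\<^sub>0"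
    using u(2) by (simp flip: mult.assoc const_mult)
  finally show ?thesis .
qed

definition M :: "nat \<Rightarrow> nat \<Rightarrow> 'k" where
  "M k i = pt.ev u (a k i)"

text \<open>
  Expressing \<open>\<delta> g\<^sub>k\<close> in two ways through the \<open>g\<^sub>k\<close> shows that \<open>a s = \<delta>\<close> as matrices over \<open>R\<^sub>m\<close>;
  evaluation at \<open>u\<close> makes \<open>M\<close> invertible.
\<close>

lemma M_inverse:
  assumes k: "k < length ns" "k' < length ns"
  shows "(\<Sum>i<length ms. M k i * pt.ev u (s i k')) = (if k = k' then pt.ev u \<delta> else 0)"
proof -
  \<comment> \<open>w is row k of the matrix a s - \<delta>. Its combination in g lies in I_X, so
    freeness of g makes the row zero.\<close>
  define w where "w = (\<lambda>j. (\<Sum>i<length ms. a k i * s i j) - \<delta> * (if j = k then 1 else 0))"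
  have ap: "a k i \<in> polys m" if "i < length ms" for i
    using a(1)[OF k(1)] that by (simp add: grade_shifted_sum carrier_shifted_sum)
  have sc: "s i \<in> carrier (shifted_sum m ns)" if "i < length ms" for i
    using s(1)[OF that] by (simp add: grade_shifted_sum)
  have wc: "w \<in> carrier (shifted_sum m ns)"
    using ap sc k \<delta>(1)
    by (auto simp: w_def carrier_shifted_sum intro!: polys_diff polys_sum polys_mult)
  have unit: "comb Ys ns g (\<lambda>j. if j = k then 1 else 0) = g k"
    using k(1) by (simp add: comb_def if_distrib[of "subst Ys"] if_distrib[of "\<lambda>x. x * _"] sum.delta
        cong: if_cong)
  have "comb Ys ns g w = (\<Sum>i<length ms. subst Ys (a k i) * comb Ys ns g (s i)) - subst Ys \<delta> * g k"
    unfolding w_def by (simp only: comb_diff comb_sum comb_mult unit)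
  \<comment> \<open>Both sums contain \<delta> times the e-expansion of g_k, which cancels; only
    errors of the two expansions remain, and these lie in I_X.\<close>
  also have "\<dots> = - (\<Sum>i<length ms. subst Ys (a k i) * (subst Ys \<delta> * e i - comb Ys ns g (s i)))
      - subst Ys \<delta> * (g k - comb Ys ms e (a k))"
    by (simp add: comb_def[of Ys ms] right_diff_distrib sum_subtractf sum_distrib_left mult_ac)
  also have "\<dots> \<in> IX"
  proof (rule ideal_diff[OF IX], rule ideal_uminus[OF IX], rule ideal_sum[OF IX])
    fix i assume i: "i \<in> {..<length ms}"
    then show "subst Ys (a k i) * (subst Ys \<delta> * e i - comb Ys ns g (s i)) \<in> IX"
      by (intro ideal_mult[OF IX s(2)] subst_polys[OF Ys ap]) auto
  next
    show "subst Ys \<delta> * (g k - comb Ys ms e (a k)) \<in> IX"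
      by (rule ideal_mult[OF IX a(2)[OF k(1)] subst_polys[OF Ys \<delta>(1)]])
  qed
  finally have "w k' = 0" using g_free[OF wc] by simp
  then have "pt.ev u (\<Sum>i<length ms. a k i * s i k') = pt.ev u (\<delta> * (if k' = k then 1 else 0))"
    by (simp add: w_def)
  then show ?thesis by (auto simp: pt.ev_sum pt.ev_mult M_def)
qed

text \<open>The entry \<open>a k i\<close> would have negative degree n_k - m_i. Thus rows with n_k
  \<le> l are supported on the columns with m_i \<le> l.\<close>

lemma M_zero: "k < length ns \<Longrightarrow> i < length ms \<Longrightarrow> ns ! k < ms ! i \<Longrightarrow> M k i = 0"
  using a(1)[of k] by (auto simp: grade_shifted_sum M_def)

text \<open>Over k[Y_m] each free summand with shift at most l has exactly one dimension in degree
  l; these are the summands counted.\<close>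

definition C :: "nat list \<Rightarrow> nat \<Rightarrow> nat set" where
  "C qs l = {i. i < length qs \<and> qs ! i \<le> l}"

lemma finite_C [simp]: "finite (C qs l)"
  by (simp add: C_def)

text \<open>By \<open>M_zero\<close> a relation between the truncated rows is a relation between the
  full rows, and multiplication by s(u) recovers \<delta>(u) times its coefficients.\<close>

lemma M_rows_independent:
  assumes x: "\<forall>i\<in>C ms l. (\<Sum>k\<in>C ns l. x k * M k i) = 0" and k: "k \<in> C ns l"
  shows "x k = 0"
proof -
  have "(\<Sum>k\<in>C ns l. x k * M k i) = 0" if "i < length ms" for i
  proof (cases "ms ! i \<le> l")
    case True
    then show ?thesis using x that by (simp add: C_def)
  next
    case False
    then have "M k i = 0" if "k \<in> C ns l" for k
      using M_zero[of k i] \<open>i < length ms\<close> that by (auto simp: C_def)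
    then show ?thesis by simp
  qed
  then have "0 = (\<Sum>i<length ms. (\<Sum>k'\<in>C ns l. x k' * M k' i) * pt.ev u (s i k))"
    by simp
  also have "\<dots> = (\<Sum>k'\<in>C ns l. x k' * (\<Sum>i<length ms. M k' i * pt.ev u (s i k)))"
    unfolding sum_distrib_right sum_distrib_left mult.assoc by (rule sum.swap)
  also have "\<dots> = (\<Sum>k'\<in>C ns l. if k' = k then x k * pt.ev u \<delta> else 0)"
    using k by (intro sum.cong) (auto simp: M_inverse C_def)
  also have "\<dots> = x k * pt.ev u \<delta>" using k by simp
  finally show ?thesis using u(2) by simp
qed

text \<open>The generator e_i raised to degree l by Y_m. Modulo J these elements span everything of
  degree l.\<close>

definition w :: "nat \<Rightarrow> nat \<Rightarrow> 'k mpoly" where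
  "w l i = Y ^ (l - ms ! i) * e i"

lemma w_deg: "i \<in> C ms l \<Longrightarrow> w l i \<in> deg_part (polys n) l"
  using e_deg[of i] Y_polys homog_mult[OF homog_power[OF Y_homog, of "l - ms ! i"], of "ms ! i" "e i"]
  by (auto simp: w_def C_def deg_part_def intro: polys_mult polys_power)

lemma comb_J:
  assumes v: "v \<in> grade (shifted_sum m ms) l"
  shows "comb Ys ms e v - (\<Sum>i\<in>C ms l. const (pt.ev u (v i)) * w l i) \<in> J"
proof -
  have "comb Ys ms e v = (\<Sum>i\<in>C ms l. subst Ys (v i) * e i)"
    unfolding comb_def C_def
    by (rule sum.mono_neutral_right) (use v in \<open>auto simp: grade_shifted_sum not_le\<close>)
  then have "comb Ys ms e v - (\<Sum>i\<in>C ms l. const (pt.ev u (v i)) * w l i) =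
      (\<Sum>i\<in>C ms l. (subst Ys (v i) - const (pt.ev u (v i)) * Y ^ (l - ms ! i)) * e i)"
    by (simp add: w_def left_diff_distrib sum_subtractf mult.assoc)
  also have "\<dots> \<in> J"
  proof (rule ideal_sum[OF ideal_J], rule ideal_mult'[OF ideal_J], rule subst_J)
    fix i assume i: "i \<in> C ms l"
    then show "v i \<in> polys m" "homog (l - ms ! i) (v i)"
      using v by (auto simp: C_def grade_shifted_sum carrier_shifted_sum)
    show "e i \<in> polys n" using e_deg[of i] i by (simp add: C_def deg_part_def)
  qed
  finally show ?thesis .
qed

text \<open>The element g_k of I_Y gives a relation in degree n_k, which multiplication by a power
  of Y_m carries to degree l.\<close>

lemma relation_J:
  assumes k: "k \<in> C ns l"
  shows "(\<Sum>i\<in>C ms l. const (M k i) * w l i) \<in> J"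
proof -
  have k': "k < length ns" "ns ! k \<le> l" using k by (auto simp: C_def)
  have "g k \<in> J" using g_deg[OF k'(1)] by (simp add: deg_part_def IY_J)
  moreover have "g k - comb Ys ms e (a k) \<in> J" using a(2)[OF k'(1)] IXY IY_J by blast
  ultimately have "comb Ys ms e (a k) \<in> J" using ideal_diff[OF ideal_J] by fastforce
  then have "(\<Sum>i\<in>C ms (ns ! k). const (M k i) * w (ns ! k) i) \<in> J"
    using ideal_diff[OF ideal_J _ comb_J[OF a(1)[OF k'(1)]]] by (fastforce simp: M_def)
  then have "Y ^ (l - ns ! k) * (\<Sum>i\<in>C ms (ns ! k). const (M k i) * w (ns ! k) i) \<in> J"
    using Y_polys by (intro ideal_mult[OF ideal_J] polys_power)
  also have "Y ^ (l - ns ! k) * (\<Sum>i\<in>C ms (ns ! k). const (M k i) * w (ns ! k) i) =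
      (\<Sum>i\<in>C ms (ns ! k). const (M k i) * w l i)"
    unfolding sum_distrib_left
  proof (rule sum.cong)
    fix i assume "i \<in> C ms (ns ! k)"
    then have "l - ms ! i = (l - ns ! k) + (ns ! k - ms ! i)" using k' by (auto simp: C_def)
    then have "Y ^ (l - ms ! i) = Y ^ (l - ns ! k) * Y ^ (ns ! k - ms ! i)" by (simp only: power_add)
    then show "Y ^ (l - ns ! k) * (const (M k i) * w (ns ! k) i) = const (M k i) * w l i"
      by (simp add: w_def mult_ac)
  qed simp
  \<comment> \<open>The added indices have m_i > n_k, where \<open>M k i\<close> is zero.\<close>
  also have "\<dots> = (\<Sum>i\<in>C ms l. const (M k i) * w l i)"
  proof (rule sum.mono_neutral_left)
    show "\<forall>i\<in>C ms l - C ms (ns ! k). const (M k i) * w l i = 0"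
      using M_zero[OF k'(1)] by (auto simp: C_def not_le)
  qed (use k' in \<open>auto simp: C_def\<close>)
  finally show ?thesis .
qed

text \<open>The rows of M are relations among the w_i, so by exchange only the w_i with i in E are
  needed. Spanning suffices here; freeness will come from dimensions.\<close>

lemma spanning_subset:
  "\<exists>E\<subseteq>C ms l. card E + card (C ns l) = card (C ms l) \<and>
    (\<forall>f\<in>deg_part (polys n) l. \<exists>z. f - (\<Sum>i\<in>E. const (z i) * w l i) \<in> J)"
proof -
  have "\<exists>E\<subseteq>C ms l. card E + card (C ns l) = card (C ms l) \<and>
    (\<forall>v. \<exists>y z. \<forall>j\<in>C ms l. v j = (\<Sum>k\<in>C ns l. y k * M k j) + (if j \<in> E then z j else 0))"
  proof (rule exchange_rows)
    show "\<forall>k\<in>C ns l. x k = 0" if "\<forall>i\<in>C ms l. (\<Sum>k\<in>C ns l. x k * M k i) = 0" for x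
      using M_rows_independent[OF that] by blast
  qed (rule finite_C)+
  then obtain E where E: "E \<subseteq> C ms l" "card E + card (C ns l) = card (C ms l)"
    and rep: "\<And>v. \<exists>y z. \<forall>j\<in>C ms l. v j = (\<Sum>k\<in>C ns l. y k * M k j) + (if j \<in> E then z j else 0)"
    by blast
  have "\<exists>z. f - (\<Sum>i\<in>E. const (z i) * w l i) \<in> J" if f: "f \<in> deg_part (polys n) l" for f
  proof -
    obtain v where v: "v \<in> grade (shifted_sum m ms) l" "f - comb Ys ms e v \<in> IX"
      using e_gen[OF f] by blast
    obtain y z where yz: "\<And>j. j \<in> C ms l \<Longrightarrow>
        pt.ev u (v j) = (\<Sum>k\<in>C ns l. y k * M k j) + (if j \<in> E then z j else 0)"
      using rep[of "\<lambda>j. pt.ev u (v j)"] by blast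
    have "(\<Sum>j\<in>C ms l. const (pt.ev u (v j)) * w l j) =
        (\<Sum>j\<in>C ms l. (\<Sum>k\<in>C ns l. const (y k) * (const (M k j) * w l j)) +
          (if j \<in> E then const (z j) * w l j else 0))"
    proof (rule sum.cong)
      fix j assume j: "j \<in> C ms l"
      have "const (pt.ev u (v j)) =
          (\<Sum>k\<in>C ns l. const (y k) * const (M k j)) + (if j \<in> E then const (z j) else 0)"
        unfolding yz[OF j] by (simp add: const_add const_sum const_mult)
      then show "const (pt.ev u (v j)) * w l j = (\<Sum>k\<in>C ns l. const (y k) * (const (M k j) * w l j)) +
          (if j \<in> E then const (z j) * w l j else 0)"
        by (simp only: distrib_right sum_distrib_right mult.assoc) simp
    qed simp
    also have "\<dots> = (\<Sum>k\<in>C ns l. const (y k) * (\<Sum>j\<in>C ms l. const (M k j) * w l j)) +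
          (\<Sum>j\<in>E. const (z j) * w l j)"
      unfolding sum.distrib sum_distrib_left
      using E(1) by (subst sum.swap) (simp add: sum.inter_restrict[symmetric] Int_absorb1)
    finally have *: "f - (\<Sum>j\<in>E. const (z j) * w l j) = (f - comb Ys ms e v) +
        ((comb Ys ms e v - (\<Sum>j\<in>C ms l. const (pt.ev u (v j)) * w l j)) +
        (\<Sum>k\<in>C ns l. const (y k) * (\<Sum>j\<in>C ms l. const (M k j) * w l j)))"
      by simp
    have "f - (\<Sum>j\<in>E. const (z j) * w l j) \<in> J"
      unfolding *
      by (intro ideal_add[OF ideal_J] comb_J[OF v(1)] ideal_sum[OF ideal_J] ideal_mult[OF ideal_J]
          relation_J polys_const IY_J subsetD[OF IXY v(2)])
    then show ?thesis by blast
  qed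
  then show ?thesis using E by blast
qed

lemma ms_le_ns:
  assumes "i < length ms"
  shows "ms ! i \<le> ns ! i"
proof (rule nth_le_if_card_le[OF sorted_ms sorted_ns len _ assms])
  fix l
  have "card (C ns l) \<le> card (C ms l)" using spanning_subset[of l] by (metis le_add2)
  then show "card {k. k < length ns \<and> ns ! k \<le> l} \<le> card {i. i < length ms \<and> ms ! i \<le> l}"
    by (simp add: C_def)
qed

end

section \<open>From generators of the quotient to a basis of the coordinate ring of Y\<close>

context hypersurface_section
begin

definition ps :: "nat list" where
  "ps = sort (concat (map (\<lambda>i. [ms ! i..<ns ! i]) [0..<length ms]))"

text \<open>The entry l occurs once for each i with m_i \<le> l < n_i. Since m_i \<le> n_i, these i
  complement those with n_i \<le> l among those with m_i \<le> l, so the multiplicity equals the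
  size of the set E in degree l.\<close>

lemma card_ps: "card {i. i < length ps \<and> ps ! i = l} + card (C ns l) = card (C ms l)"
proof -
  let ?C = "concat (map (\<lambda>i. [ms ! i..<ns ! i]) [0..<length ms])"
  have up: "length (filter (\<lambda>j. j = l) [p..<q]) = (if p \<le> l \<and> l < q then 1 else 0)" for p q
  proof -
    have "length (filter (\<lambda>j. j = l) [p..<q]) = card {j \<in> {p..<q}. j = l}"
      by (subst distinct_length_filter) (auto intro: arg_cong[where f = card])
    also have "{j \<in> {p..<q}. j = l} = (if p \<le> l \<and> l < q then {l} else {})" by auto
    finally show ?thesis by simp
  qed
  have "card {i. i < length ps \<and> ps ! i = l} = length (filter (\<lambda>j. j = l) ps)"
    by (simp add: length_filter_conv_card)
  also have "\<dots> = length (filter (\<lambda>j. j = l) ?C)"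
    unfolding ps_def by (rule mset_eq_length) simp
  also have "\<dots> = (\<Sum>i\<leftarrow>[0..<length ms]. length (filter (\<lambda>j. j = l) [ms ! i..<ns ! i]))"
    by (simp add: filter_concat length_concat o_def)
  also have "\<dots> = (\<Sum>i<length ms. if ms ! i \<le> l \<and> l < ns ! i then 1 else 0)"
    unfolding up by (simp add: interv_sum_list_conv_sum_set_nat atLeast0LessThan)
  also have "\<dots> = card {i. i < length ms \<and> ms ! i \<le> l \<and> l < ns ! i}"
  proof -
    have "{i \<in> {..<length ms}. ms ! i \<le> l \<and> l < ns ! i} = {i. i < length ms \<and> ms ! i \<le> l \<and> l < ns ! i}"
      by auto
    then show ?thesis by (simp add: sum.If_cases Int_def)
  qed
  finally have 1: "card {i. i < length ps \<and> ps ! i = l} = card {i. i < length ms \<and> ms ! i \<le> l \<and> l < ns ! i}" .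
  have "C ms l = {i. i < length ms \<and> ms ! i \<le> l \<and> l < ns ! i} \<union> C ns l"
    using ms_le_ns len by (auto simp: C_def intro: order_trans)
  moreover have "{i. i < length ms \<and> ms ! i \<le> l \<and> l < ns ! i} \<inter> C ns l = {}"
    by (auto simp: C_def)
  ultimately show ?thesis
    unfolding 1 by (simp add: card_Un_disjoint)
qed

lemma hilb_sum_ps: "hilb_sum (m - 1) l ps + hilb_sum m l ns = hilb_sum m l ms"
  unfolding ps_def using hilb_sum_sort_concat[OF m, of ms ns] ms_le_ns len by simp

lemma Zs_deg': "i \<le> m - 1 \<Longrightarrow> Zs ! i \<in> deg_part (polys n) 1"
  using Zs_deg[of i] m by simp

text \<open>In each degree the chosen w_i are reindexed along a bijection by the positions of that
  degree in \<open>ps\<close>, which exists by \<open>card_ps\<close>.\<close>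

lemma generators:
  "\<exists>e'. (\<forall>i<length ps. e' i \<in> deg_part (polys n) (ps ! i)) \<and>
    (\<forall>l. \<forall>f\<in>deg_part (polys n) l. \<exists>z. f - (\<Sum>i | i < length ps \<and> ps ! i = l. const (z i) * e' i) \<in> J)"
proof -
  define P where "P l = {i. i < length ps \<and> ps ! i = l}" for l
  have finP: "finite (P l)" for l by (simp add: P_def)
  have "\<exists>E. \<forall>l. E l \<subseteq> C ms l \<and> card (E l) + card (C ns l) = card (C ms l) \<and>
      (\<forall>f\<in>deg_part (polys n) l. \<exists>z. f - (\<Sum>i\<in>E l. const (z i) * w l i) \<in> J)"
    by (rule choice) (use spanning_subset in blast)
  then obtain E where E: "\<And>l. E l \<subseteq> C ms l" "\<And>l. card (E l) + card (C ns l) = card (C ms l)"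
    and gen: "\<And>l f. f \<in> deg_part (polys n) l \<Longrightarrow> \<exists>z. f - (\<Sum>i\<in>E l. const (z i) * w l i) \<in> J"
    by blast
  have "\<exists>\<beta>. bij_betw \<beta> (P l) (E l)" for l
  proof (rule finite_same_card_bij[OF finP])
    show "finite (E l)" using E(1) finite_C by (rule finite_subset)
    show "card (P l) = card (E l)" using E(2)[of l] card_ps[of l] by (simp add: P_def)
  qed
  then obtain \<beta> where \<beta>: "\<And>l. bij_betw (\<beta> l) (P l) (E l)" by metis
  define e' where "e' i = w (ps ! i) (\<beta> (ps ! i) i)" for i
  have "e' i \<in> deg_part (polys n) (ps ! i)" if "i < length ps" for i
  proof -
    have "\<beta> (ps ! i) i \<in> E (ps ! i)"
      using \<beta>[of "ps ! i"] that by (auto simp: P_def dest: bij_betwE)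
    then show ?thesis using w_deg E(1) by (auto simp: e'_def)
  qed
  moreover have "\<exists>z. f - (\<Sum>i\<in>P l. const (z i) * e' i) \<in> J" if "f \<in> deg_part (polys n) l" for f l
  proof -
    obtain z where z: "f - (\<Sum>i\<in>E l. const (z i) * w l i) \<in> J" using gen \<open>f \<in> _\<close> by blast
    have "(\<Sum>i\<in>E l. const (z i) * w l i) = (\<Sum>i\<in>P l. const (z (\<beta> l i)) * w l (\<beta> l i))"
      by (rule sum.reindex_bij_betw[OF \<beta>, symmetric])
    also have "\<dots> = (\<Sum>i\<in>P l. const (z (\<beta> l i)) * e' i)"
      by (rule sum.cong) (auto simp: P_def e'_def)
    finally show ?thesis using z by auto
  qed
  ultimately show ?thesis unfolding P_def by blast
qed

text \<open>Graded Nakayama: modulo I_Y + (Z) the generators of degree l suffice, and the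
  coefficients of the Z_j in the remainder have degree l - 1, where induction applies.\<close>

lemma nakayama:
  assumes e': "\<And>i. i < length ps \<Longrightarrow> e' i \<in> deg_part (polys n) (ps ! i)"
    and gen: "\<And>l f. f \<in> deg_part (polys n) l \<Longrightarrow>
      \<exists>z. f - (\<Sum>i | i < length ps \<and> ps ! i = l. const (z i) * e' i) \<in> J"
    and f: "f \<in> deg_part (polys n) l"
  shows "\<exists>v\<in>grade (shifted_sum (m - 1) ps) l. f - comb Zs ps e' v \<in> IY"
  using f
proof (induction l arbitrary: f rule: less_induct)
  case (less l)
  let ?N = "shifted_sum (m - 1) ps"
  define P where "P = {i. i < length ps \<and> ps ! i = l}"
  obtain z where z: "f - (\<Sum>i\<in>P. const (z i) * e' i) \<in> J"
    using gen[OF less.prems] by (auto simp: P_def)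
  then obtain y h where y: "y \<in> IY" and h: "\<And>j. j < m \<Longrightarrow> h j \<in> polys n"
    and eq: "f - (\<Sum>i\<in>P. const (z i) * e' i) = y + (\<Sum>j<m. Zs ! j * h j)"
    by (rule J_E) blast
  \<comment> \<open>Membership in J yields coefficients that need not be homogeneous. Taking
    degree-l components keeps only their part of degree l - 1, which is empty for l = 0.\<close>
  define h' where "h' j = (if 1 \<le> l then hc (l - 1) (h j) else 0)" for j
  have "homog l (f - (\<Sum>i\<in>P. const (z i) * e' i))"
    using less.prems e'
    by (intro homog_diff homog_sum homog_const_mult) (auto simp: P_def deg_part_def)
  then have "f - (\<Sum>i\<in>P. const (z i) * e' i) = hc l (f - (\<Sum>i\<in>P. const (z i) * e' i))"
    by (simp add: hc_homog)
  also have "\<dots> = hc l y + (\<Sum>j<m. Zs ! j * h' j)"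
    unfolding eq hc_add hc_sum
  proof (intro arg_cong2[where f = "(+)"] sum.cong refl)
    fix j assume "j \<in> {..<m}"
    then have "homog 1 (Zs ! j)" using Zs_deg by (simp add: deg_part_def)
    from hc_mult_homog[OF this] show "hc l (Zs ! j * h j) = Zs ! j * h' j"
      by (simp add: h'_def mult.commute)
  qed
  finally have eq': "f - (\<Sum>i\<in>P. const (z i) * e' i) = hc l y + (\<Sum>j<m. Zs ! j * h' j)" .
  \<comment> \<open>The strict condition \<open>ps ! i < l\<close> describes degree l - 1 and also
    covers l = 0, where truncated subtraction would name degree 0 again.\<close>
  have "\<exists>v\<in>carrier ?N. (\<forall>i<length ps. if ps ! i < l then homog (l - 1 - ps ! i) (v i) else v i = 0) \<and>
      h' j - comb Zs ps e' v \<in> IY" if j: "j < m" for j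
  proof (cases l)
    case 0
    then show ?thesis
      by (intro bexI[of _ "\<lambda>i. 0"]) (auto simp: h'_def comb_def carrier_shifted_sum ideal_0[OF IY])
  next
    case (Suc l')
    then have "h' j \<in> deg_part (polys n) l'" using h[OF j] by (simp add: h'_def deg_part_def polys_hc)
    then obtain v where "v \<in> grade ?N l'" "h' j - comb Zs ps e' v \<in> IY"
      using less.IH[of l'] Suc by blast
    then show ?thesis using Suc by (intro bexI[of _ v]) (auto simp: grade_shifted_sum less_Suc_eq_le)
  qed
  then obtain v where v: "\<And>j. j < m \<Longrightarrow> v j \<in> carrier ?N"
      "\<And>j i. j < m \<Longrightarrow> i < length ps \<Longrightarrow>
        if ps ! i < l then homog (l - 1 - ps ! i) (v j i) else v j i = 0"
      "\<And>j. j < m \<Longrightarrow> h' j - comb Zs ps e' (v j) \<in> IY"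
    by metis
  define x where "x = (\<lambda>i. (if i \<in> P then const (z i) else 0))"
  \<comment> \<open>The variable with index j of R_(m-1) acts as Z_j, so this vector reassembles the
    scalar part and the inductive parts.\<close>
  define r where "r = (\<lambda>i. x i + (\<Sum>j<m. var j * v j i))"
  have vp: "v j i \<in> polys (m - 1)" if "j < m" for i j
    using v(1)[OF that] by (cases "i < length ps") (auto simp: carrier_shifted_sum)
  have "r i \<in> polys (m - 1)" for i
    using vp by (auto simp: r_def x_def intro!: polys_add polys_sum polys_mult)
  moreover have "r i = 0" if "i \<ge> length ps" for i
    using v(1) that by (auto simp: r_def x_def P_def carrier_shifted_sum)
  moreover have "if ps ! i \<le> l then homog (l - ps ! i) (r i) else r i = 0" if i: "i < length ps" for i
  proof (cases "ps ! i \<le> l")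
    case True
    have "homog (l - ps ! i) (x i)" by (auto simp: x_def P_def)
    moreover have "homog (l - ps ! i) (var j * v j i)" if j: "j < m" for j
    proof (cases "ps ! i < l")
      case True
      then have "homog (1 + (l - 1 - ps ! i)) (var j * v j i)"
        using v(2)[OF j i] by (intro homog_mult homog_var) simp
      moreover have "1 + (l - 1 - ps ! i) = l - ps ! i" using True by simp
      ultimately show ?thesis by simp
    next
      case False
      then show ?thesis using v(2)[OF j i] by simp
    qed
    ultimately show ?thesis using True by (auto simp: r_def intro!: homog_add homog_sum)
  next
    case False
    then have "x i = 0" "\<And>j. j < m \<Longrightarrow> v j i = 0" using v(2)[OF _ i] by (auto simp: x_def P_def)
    then show ?thesis using False by (simp add: r_def)
  qed
  ultimately have rN: "r \<in> grade ?N l"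
    by (simp add: grade_shifted_sum carrier_shifted_sum)
  have "comb Zs ps e' x = (\<Sum>i\<in>P. const (z i) * e' i)"
  proof -
    have "comb Zs ps e' x = (\<Sum>i<length ps. if i \<in> P then const (z i) * e' i else 0)"
      unfolding comb_def by (rule sum.cong) (auto simp: x_def)
    also have "\<dots> = (\<Sum>i\<in>{..<length ps} \<inter> P. const (z i) * e' i)" by (simp add: sum.inter_restrict)
    also have "{..<length ps} \<inter> P = P" by (auto simp: P_def)
    finally show ?thesis .
  qed
  then have "comb Zs ps e' r = (\<Sum>i\<in>P. const (z i) * e' i) + (\<Sum>j<m. Zs ! j * comb Zs ps e' (v j))"
    unfolding r_def comb_add comb_sum comb_mult by simp
  then have "f - comb Zs ps e' r = hc l y + (\<Sum>j<m. Zs ! j * (h' j - comb Zs ps e' (v j)))"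
    using eq' by (simp add: algebra_simps sum_subtractf)
  also have "\<dots> \<in> IY"
  proof (rule ideal_add[OF IY homog_ideal_hc[OF hIY y]], rule ideal_sum[OF IY])
    fix j assume "j \<in> {..<m}"
    then show "Zs ! j * (h' j - comb Zs ps e' (v j)) \<in> IY"
      using v(3) Zs_deg by (intro ideal_mult[OF IY]) (auto simp: deg_part_def)
  qed
  finally show ?case using rN by blast
qed

lemma free_gens_IY: "\<exists>e'. free_gens n (polys n) IY (m - 1) Zs ps e'"
proof -
  obtain e' where e': "\<And>i. i < length ps \<Longrightarrow> e' i \<in> deg_part (polys n) (ps ! i)"
    and gen: "\<And>l f. f \<in> deg_part (polys n) l \<Longrightarrow>
      \<exists>z. f - (\<Sum>i | i < length ps \<and> ps ! i = l. const (z i) * e' i) \<in> J"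
    using generators by blast
  have "free_gens n (polys n) IY (m - 1) Zs ps e'"
  proof (rule free_gens_if_dim[OF Zs_deg' hIY e' nakayama[OF e' gen]])
    fix l
    show "mp.dim (deg_part IY l) + hilb_sum (m - 1) l ps \<le> mp.dim (deg_part (polys n :: 'k mpoly set) l)"
      using hilb_sum_ps[of l] by (simp add: dim_IY dim_polys)
  qed
  then show ?thesis by blast
qed

lemma sorted_ps: "sorted ps"
  by (simp add: ps_def)

text \<open>The element 1 is not in I_Y, so it needs a generator of degree 0; sortedness moves that
  entry to the front.\<close>

lemma ps_0: "ps \<noteq> [] \<and> ps ! 0 = 0"
proof -
  obtain e' where e': "free_gens n (polys n) IY (m - 1) Zs ps e'" using free_gens_IY by blast
  have "1 \<in> deg_part (polys n :: 'k mpoly set) 0" by (simp add: deg_part_def)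
  then obtain v where v: "v \<in> grade (shifted_sum (m - 1) ps) 0" "1 - comb Zs ps e' v \<in> IY"
    using e' unfolding free_gens_def by blast
  have "\<exists>i<length ps. ps ! i = 0"
  proof (rule ccontr)
    assume "\<not> ?thesis"
    then have "v i = 0" if "i < length ps" for i
      using v(1) that by (auto simp: grade_shifted_sum)
    then show False using v(2) proper by (simp add: comb_def)
  qed
  then obtain i where i: "i < length ps" "ps ! i = 0" by blast
  then have "ps ! 0 \<le> ps ! i" using sorted_ps by (intro sorted_nth_mono) auto
  then show ?thesis using i by auto
qed

text \<open>A point of Y containing all Z_j contains J, hence a power of Y_m, hence Y_m by primality
  and then every Y_i, against the choice of Ys.\<close>

lemma avoiding_forms_Zs:
  assumes av: "avoiding_forms n IX m Ys"
  shows "avoiding_forms n IY (m - 1) Zs"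
proof -
  have False if P: "P \<in> proj_points n IY" "set Zs \<subseteq> P" for P
  proof -
    have prime: "primeideal P (poly_ring n)" and IYP: "IY \<subseteq> P" using P(1) by (auto simp: proj_points_def)
    have idP: "ideal P (poly_ring n)" using prime by (rule primeideal.axioms(1))
    have ZP: "Zs ! j \<in> P" if "j < m" for j
      using P(2) that by (auto simp: Zs_def)
    have "J \<subseteq> P"
    proof
      fix x assume "x \<in> J"
      then obtain y f where "y \<in> IY" "\<And>j. j < m \<Longrightarrow> f j \<in> polys n" "x = y + (\<Sum>j<m. Zs ! j * f j)"
        by (rule J_E) blast
      then show "x \<in> P"
        using IYP ZP by (auto intro!: ideal_add[OF idP] ideal_sum[OF idP] ideal_mult'[OF idP])
    qed
    have "Y \<in> P" if "Y ^ l \<in> P" for l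
      using that
    proof (induction l)
      case 0
      then have "x \<in> P" if "x \<in> polys n" for x using ideal_mult[OF idP, of 1 x] that by simp
      then have "polys n = P" using ideal_polys[OF idP] by blast
      then show ?case using primeideal.I_notcarr[OF prime] by simp
    next
      case (Suc l)
      then show ?case
        using primeideal.I_prime[OF prime, of Y "Y ^ l"] Y_polys by (auto simp: polys_power)
    qed
    then have YP: "Y \<in> P" using Y_power_J \<open>J \<subseteq> P\<close> by blast
    have "Ys ! i \<in> P" if "i \<le> m" for i
    proof (cases "i = m")
      case False
      then have "Zs ! i + Y * const (u i) \<in> P"
        using that YP ZP[of i] by (intro ideal_add[OF idP] ideal_mult'[OF idP]) auto
      then show ?thesis using False that by (simp add: Zs_nth)
    qed (simp add: YP)
    then have "set Ys \<subseteq> P"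
      using av by (auto simp: avoiding_forms_def in_set_conv_nth)
    moreover have "P \<in> proj_points n IX"
      using P(1) IXY by (auto simp: proj_points_def)
    ultimately show False using av by (auto simp: avoiding_forms_def)
  qed
  moreover have "length Zs = m - 1 + 1" using m by (simp add: Zs_def)
  moreover have "\<forall>y\<in>set Zs. y \<in> polys n \<and> homog 1 y"
    using Zs_deg by (auto simp: in_set_conv_nth Zs_def deg_part_def)
  ultimately show ?thesis unfolding avoiding_forms_def by blast
qed

lemma char_seq_ps:
  assumes "avoiding_forms n IX m Ys"
  shows "char_seq n IY (m - 1) ps"
proof -
  obtain e' where e': "free_gens n (polys n) IY (m - 1) Zs ps e'" using free_gens_IY by blast
  have "graded_iso (poly_ring (m - 1)) (coord_module n IY Zs) (shifted_sum (m - 1) ps)"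
    by (rule graded_iso_if_free_gens[OF Zs_deg' hIY e'])
  moreover have "has_degree n IY (m - 1) (length ps)"
    by (rule has_degree_free_gens[OF IY proper Zs_deg' e' conjunct1[OF ps_0]])
  ultimately show ?thesis
    unfolding char_seq_def char_seq_wrt_def using avoiding_forms_Zs[OF assms] ps_0 sorted_ps by blast
qed

end

section \<open>Uniqueness of the characteristic sequence and conclusion\<close>

lemma avoiding_forms_deg_part:
  "avoiding_forms n I m Ys \<Longrightarrow> i \<le> m \<Longrightarrow> Ys ! i \<in> deg_part (polys n) 1"
  by (simp add: avoiding_forms_def deg_part_def)

text \<open>The sequence may be computed with any forms Z; they disappear from the dimensions, so
  the Hilbert sum is determined by ms and ns.\<close>

lemma (in hypersurface) char_seq_hilb_sum:
  assumes "char_seq n IY (m - 1) qs"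
  shows "hilb_sum (m - 1) l qs + hilb_sum m l ns = hilb_sum m l ms"
proof -
  obtain Z where av: "avoiding_forms n IY (m - 1) Z"
    and iso: "graded_iso (poly_ring (m - 1)) (coord_module n IY Z) (shifted_sum (m - 1) qs)"
    using assms by (auto simp: char_seq_def char_seq_wrt_def)
  note Z = avoiding_forms_deg_part[OF av]
  have "IY \<subseteq> polys n" using ideal_polys[OF IY] by blast
  then obtain e' where e': "free_gens n (polys n) IY (m - 1) Z qs e'"
    using free_gens_if_graded_iso[OF Z IY ideal_polys_ideal] iso
      coord_module_eq_rel_ideal_module[OF Z IY] by metis
  have "mp.dim (deg_part (polys n :: 'k mpoly set) l) = mp.dim (deg_part IY l) + hilb_sum (m - 1) l qs"
    by (rule free_gens_dim[OF Z IY ideal_polys_ideal \<open>IY \<subseteq> polys n\<close> e'])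
  then show ?thesis by (simp add: dim_polys dim_IY)
qed

theorem mainTheorem5:
  fixes IX IY :: "'k::{alg_closed_field, field_char_0} mpoly set"
    and Ys :: "'k mpoly list"
    and n m d :: nat
    and ms ns :: "nat list"
  assumes "proj_subscheme n IX" and "arith_CM n IX m" and "pure_dim n IX m" and "m \<ge> 1"
    and "has_degree n IX m d"
    and "avoiding_forms n IX m Ys"
    and "char_seq_wrt n IX m Ys ms"
    and "ACM_hypersurface n IX m IY"
    and "rel_char_seq_wrt n IX m Ys IY ns"
  shows "(\<forall>i<d. ms ! i \<le> ns ! i) \<and>
    (\<forall>ps. char_seq n IY (m - 1) ps \<longleftrightarrow>
       ps = sort (concat (map (\<lambda>i. [ms ! i..<ns ! i]) [0..<d])))"
proof -
  have IX: "ideal IX (poly_ring n)"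
    using assms(1) by (simp add: proj_subscheme_def homog_ideal_def)
  have hIY: "homog_ideal n IY" and IXY: "IX \<subseteq> IY" and points: "proj_points n IY \<noteq> {}"
    using assms(8) by (auto simp: ACM_hypersurface_def proj_subscheme_def pure_dim_def)
  have IY: "ideal IY (poly_ring n)" using hIY by (simp add: homog_ideal_def)
  note Ys = avoiding_forms_deg_part[OF assms(6)]
  \<comment> \<open>The lengths are known only as degrees of X, so uniqueness of the degree
    identifies them.\<close>
  have d: "length ms = d" "length ns = d"
    using has_degree_unique assms(5,7,9) by (auto simp: char_seq_wrt_def rel_char_seq_wrt_def)
  obtain P where P: "primeideal P (poly_ring n)" "IY \<subseteq> P" "\<not> (\<forall>i\<le>n. var i \<in> P)"
    using points by (auto simp: proj_points_def)
  have idP: "ideal P (poly_ring n)" using P(1) by (rule primeideal.axioms(1))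
  have proper: "1 \<notin> IY"
  proof
    assume "1 \<in> IY"
    then have "var i \<in> P" if "i \<le> n" for i
      using ideal_mult[OF idP, of 1 "var i"] P(2) that by auto
    then show False using P(3) by blast
  qed
  have "IX \<subseteq> polys n" using ideal_polys[OF IX] by blast
  moreover have "graded_iso (poly_ring m) (rel_ideal_module n IX Ys (polys n)) (shifted_sum m ms)"
    using assms(7) coord_module_eq_rel_ideal_module[OF Ys IX] by (simp add: char_seq_wrt_def)
  ultimately obtain e where e: "free_gens n (polys n) IX m Ys ms e"
    using free_gens_if_graded_iso[OF Ys IX ideal_polys_ideal] by blast
  have "graded_iso (poly_ring m) (rel_ideal_module n IX Ys IY) (shifted_sum m ns)"
    using assms(9) by (simp add: rel_char_seq_wrt_def)
  then obtain g where g: "free_gens n IY IX m Ys ns g"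
    using free_gens_if_graded_iso[OF Ys IX IY IXY] by blast
  have len: "length ns = length ms" and sorted: "sorted ms" "sorted ns"
    using d assms(7,9) by (simp_all add: char_seq_wrt_def rel_char_seq_wrt_def)
  interpret hypersurface n m IX IY Ys ms ns e g
    by (rule hypersurface.intro) (fact IX hIY IXY proper assms(4) Ys len sorted e g)+
  obtain l\<^sub>0 \<delta> where \<delta>: "\<delta> \<noteq> 0" "\<delta> \<in> polys m" "homog l\<^sub>0 \<delta>" "subst Ys \<delta> \<in> IY"
    using annihilator by blast
  obtain u where u: "u m = 1" "pt.ev u \<delta> \<noteq> 0"
    using nonvanishing_point_normalised[OF \<delta>(1,3), of m] by blast
  have "\<exists>v\<in>grade (shifted_sum m ms) (ns ! k). g k - comb Ys ms e v \<in> IX" if "k < length ns" for k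
    using g_deg[OF that] ideal_polys[OF IY] by (intro e_gen) (auto simp: deg_part_def)
  then obtain a where a: "\<And>k. k < length ns \<Longrightarrow> a k \<in> grade (shifted_sum m ms) (ns ! k)"
      "\<And>k. k < length ns \<Longrightarrow> g k - comb Ys ms e (a k) \<in> IX"
    by metis
  \<comment> \<open>Because \<delta> annihilates A_Y, the product with e_i lies in I_Y, in degree
    l_0 + m_i, and can be expanded in g.\<close>
  have "\<exists>v\<in>grade (shifted_sum m ns) (l\<^sub>0 + ms ! i). subst Ys \<delta> * e i - comb Ys ns g v \<in> IX"
    if "i < length ms" for i
    using e_deg[OF that] \<delta> homog_mult[OF subst_homog[OF Ys \<delta>(2,3)], of "ms ! i" "e i"]
    by (intro g_gen) (auto simp: deg_part_def intro: ideal_mult'[OF IY])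
  then obtain s where s: "\<And>i. i < length ms \<Longrightarrow> s i \<in> grade (shifted_sum m ns) (l\<^sub>0 + ms ! i)"
      "\<And>i. i < length ms \<Longrightarrow> subst Ys \<delta> * e i - comb Ys ns g (s i) \<in> IX"
    by metis
  interpret hypersurface_section n m IX IY Ys ms ns e g \<delta> l\<^sub>0 u a s
    by (intro hypersurface_section.intro hypersurface_section_axioms.intro hypersurface_axioms)
      (fact \<delta> u a s)+
  have ps: "ps = sort (concat (map (\<lambda>i. [ms ! i..<ns ! i]) [0..<d]))"
    by (simp add: ps_def d)
  have "qs = ps" if "char_seq n IY (m - 1) qs" for qs
  proof (rule hilb_sum_inj[OF _ sorted_ps])
    show "sorted qs" using that by (auto simp: char_seq_def char_seq_wrt_def)
    show "hilb_sum (m - 1) l qs = hilb_sum (m - 1) l ps" for l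
      using char_seq_hilb_sum[OF that, of l] hilb_sum_ps[of l] by simp
  qed
  then show ?thesis
    using char_seq_ps[OF assms(6)] ms_le_ns unfolding d ps[symmetric] by blast
qed

end
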